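(* Let $k$ be a field and $A = k[[t^5, t^6, t^9]] \subseteq k[[t]]$. Let $\mathcal{X}_A$ denote the set of Ulrich ideals of $A$. Then $$\mathcal{X}_A=\{(t^6 +\alpha t^{10},\ t^9 + \beta t^{10}) \mid \alpha, \beta \in k,\ 2\beta = 0\}.$$ Moreover, for each $I \in \mathcal{X}_A$, the elements $\alpha, \beta \in k$ (with $2\beta=0$) in the expression $I =(t^6 +\alpha t^{10}, t^9 + \beta t^{10})$ are uniquely determined by $I$.
   Context: $k[[t]]$ is the formal power series ring over the field $k$, and $k[[t^{5},t^{6},t^{9}]]$ is the semigroup ring of the numerical semigroup $\langle 5,6,9\rangle$, i.e. the subring of $k[[t]]$ of power series whose exponents lie in $\langle 5,6,9\rangle$. It is a one-dimensional Cohen-Macaulay local ring. Ulrich ideal: let $(A,\mathfrak m)$ be a Cohen-Macaulay local ring of dimension one and $I$ an $\mathfrak m$-primary ideal containing a parameter ideal $Q=(x)$ as a reduction. $I$ is an Ulrich ideal of $A$ if (1) $I \neq Q$ and $I^2=QI$, and (2) $I/I^2$ is a free $A/I$-module. (Condition (1) does not depend on the choice of the reduction $Q$.) *)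

theory Defs
  imports "HOL-Computational_Algebra.Formal_Power_Series" "HOL-Algebra.Algebra"
begin

section \<open>One-dimensional Cohen-Macaulay local rings\<close>

definition prime_chain :: "('a, 'b) ring_scheme \<Rightarrow> nat \<Rightarrow> (nat \<Rightarrow> 'a set) \<Rightarrow> bool" where
  "prime_chain R n P \<longleftrightarrow>
     (\<forall>i\<le>n. primeideal (P i) R) \<and> (\<forall>i<n. P i \<subset> P (Suc i))"

definition krull_dim_eq :: "('a, 'b) ring_scheme \<Rightarrow> nat \<Rightarrow> bool" where
  "krull_dim_eq R d \<longleftrightarrow> (\<exists>P. prime_chain R d P) \<and> (\<forall>n P. prime_chain R n P \<longrightarrow> n \<le> d)"

text \<open>A Noetherian local ring of dimension one has depth at most one, so it is Cohen-Macaulay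
  iff its depth is at least one, i.e. iff the maximal ideal contains a non-zerodivisor.\<close>

locale cm_local_ring_dim1 = cring R + noetherian_ring R for R (structure) and \<mm> +
  assumes local: "{J. maximalideal J R} = {\<mm>}"
    and dim_one: "krull_dim_eq R 1"
    and depth_pos: "\<exists>x\<in>\<mm>. \<forall>y\<in>carrier R. x \<otimes> y = \<zero> \<longrightarrow> y = \<zero>"


section \<open>Ulrich ideals\<close>

definition radical_ideal :: "('a, 'b) ring_scheme \<Rightarrow> 'a set \<Rightarrow> 'a set" where
  "radical_ideal R I = {x \<in> carrier R. \<exists>n::nat. x [^]\<^bsub>R\<^esub> n \<in> I}"

definition primary_to :: "('a, 'b) ring_scheme \<Rightarrow> 'a set \<Rightarrow> 'a set \<Rightarrow> bool" where
  "primary_to R \<mm> I \<longleftrightarrow> ideal I R \<and> I \<noteq> carrier R \<and>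
     (\<forall>a\<in>carrier R. \<forall>b\<in>carrier R. a \<otimes>\<^bsub>R\<^esub> b \<in> I \<longrightarrow> a \<in> I \<or> b \<in> radical_ideal R I) \<and>
     radical_ideal R I = \<mm>"

text \<open>In dimension one, a parameter ideal is an ideal generated by a single element
  that is primary to the maximal ideal.\<close>

definition parameter_ideal :: "('a, 'b) ring_scheme \<Rightarrow> 'a set \<Rightarrow> 'a set \<Rightarrow> bool" where
  "parameter_ideal R \<mm> Q \<longleftrightarrow> (\<exists>x\<in>carrier R. Q = Idl\<^bsub>R\<^esub> {x}) \<and> primary_to R \<mm> Q"

definition is_reduction :: "('a, 'b) ring_scheme \<Rightarrow> 'a set \<Rightarrow> 'a set \<Rightarrow> bool" where
  "is_reduction R Q I \<longleftrightarrow> ideal Q R \<and> Q \<subseteq> I \<and>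
     (\<exists>n::nat. I [^]\<^bsub>ideals_set R\<^esub> Suc n = Q \<cdot>\<^bsub>R\<^esub> (I [^]\<^bsub>ideals_set R\<^esub> n))"

definition module_basis :: "('a, 'b) ring_scheme \<Rightarrow> ('a, 'm, 'c) module_scheme \<Rightarrow> 'm set \<Rightarrow> bool" where
  "module_basis R M B \<longleftrightarrow> B \<subseteq> carrier M \<and>
     (\<forall>x\<in>carrier M. \<exists>F c. finite F \<and> F \<subseteq> B \<and> c \<in> F \<rightarrow> carrier R \<and>
        x = finsum M (\<lambda>b. c b \<odot>\<^bsub>M\<^esub> b) F) \<and>
     (\<forall>F c. finite F \<and> F \<subseteq> B \<and> c \<in> F \<rightarrow> carrier R \<and>
        finsum M (\<lambda>b. c b \<odot>\<^bsub>M\<^esub> b) F = \<zero>\<^bsub>M\<^esub> \<longrightarrow> (\<forall>b\<in>F. c b = \<zero>\<^bsub>R\<^esub>))"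

definition free_module :: "('a, 'b) ring_scheme \<Rightarrow> ('a, 'm, 'c) module_scheme \<Rightarrow> bool" where
  "free_module R M \<longleftrightarrow> module R M \<and> (\<exists>B. module_basis R M B)"

text \<open>The module $I/I^2$ over $R/I$: its elements are the cosets $I^2 + x$ with $x \in I$, and
  $(I + a) \cdot (I^2 + x) = I^2 + a x$. The fields \<open>mult\<close> and \<open>one\<close> are inherited from the record
  type of modules and carry no meaning.\<close>

definition conormal_module :: "('a, 'b) ring_scheme \<Rightarrow> 'a set \<Rightarrow> ('a set, 'a set) module" where
  "conormal_module R I =
     \<lparr>carrier = (\<lambda>x. (I \<cdot>\<^bsub>R\<^esub> I) +>\<^bsub>R\<^esub> x) ` I,
      mult = undefined, one = undefined,
      ring.zero = I \<cdot>\<^bsub>R\<^esub> I, ring.add = set_add R,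
      smult = rcoset_mult R (I \<cdot>\<^bsub>R\<^esub> I)\<rparr>"

definition ulrich_ideal :: "('a, 'b) ring_scheme \<Rightarrow> 'a set \<Rightarrow> bool" where
  "ulrich_ideal R I \<longleftrightarrow> (\<exists>\<mm>. cm_local_ring_dim1 R \<mm> \<and> primary_to R \<mm> I \<and>
     (\<exists>Q. parameter_ideal R \<mm> Q \<and> is_reduction R Q I \<and> I \<noteq> Q \<and> I \<cdot>\<^bsub>R\<^esub> I = Q \<cdot>\<^bsub>R\<^esub> I) \<and>
     free_module (R Quot I) (conormal_module R I))"

definition ulrich_ideals :: "('a, 'b) ring_scheme \<Rightarrow> 'a set set" where
  "ulrich_ideals R = {I. ulrich_ideal R I}"


section \<open>The semigroup ring $k[[t^5, t^6, t^9]]$\<close>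

definition semigroup569 :: "nat set" where
  "semigroup569 = {5 * a + 6 * b + 9 * c | a b c. True}"

definition semigroup_ring569 :: "'k::field fps ring" where
  "semigroup_ring569 =
     \<lparr>carrier = {f. \<forall>n. fps_nth f n \<noteq> 0 \<longrightarrow> n \<in> semigroup569},
      mult = (*), one = 1, ring.zero = 0, ring.add = (+)\<rparr>"


section \<open>Well-formedness of the definitions\<close>

lemma (in ideal) conormal_smult:
  assumes "cring R" "a \<in> carrier R" "x \<in> I"
  shows "(I +> a) \<odot>\<^bsub>conormal_module R I\<^esub> ((I \<cdot> I) +> x) = (I \<cdot> I) +> (a \<otimes> x)"
proof -
  interpret cring R by fact
  have J: "ideal (I \<cdot> I) R" using ideal_prod_is_ideal[OF is_ideal is_ideal] .
  interpret J: ideal "I \<cdot> I" R by fact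
  have xc: "x \<in> carrier R" using assms by auto
  have key: "(I \<cdot> I) +> (a' \<otimes> x') = (I \<cdot> I) +> (a \<otimes> x)"
    if a': "a' \<in> I +> a" and x': "x' \<in> (I \<cdot> I) +> x" for a' x'
  proof -
    obtain i where i: "i \<in> I" "a' = i \<oplus> a" using a' by (auto simp: a_r_coset_def')
    obtain j where j: "j \<in> I \<cdot> I" "x' = j \<oplus> x" using x' by (auto simp: a_r_coset_def')
    have ic: "i \<in> carrier R" and jc: "j \<in> carrier R" using i j by (auto intro: J.a_Hcarr)
    have "a' \<otimes> x' = ((i \<oplus> a) \<otimes> j \<oplus> i \<otimes> x) \<oplus> a \<otimes> x"
      unfolding i j using ic jc xc assms by algebra
    moreover have "(i \<oplus> a) \<otimes> j \<oplus> i \<otimes> x \<in> I \<cdot> I"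
      using i j ic assms by (intro J.a_closed J.I_l_closed ideal_prod.prod) auto
    ultimately have "a' \<otimes> x' \<in> (I \<cdot> I) +> (a \<otimes> x)" by (auto simp: a_r_coset_def')
    then show ?thesis
      using a_repr_independence[of "a' \<otimes> x'" "I \<cdot> I" "a \<otimes> x"] J.a_subgroup xc assms by simp
  qed
  have ne: "a \<in> I +> a" "x \<in> (I \<cdot> I) +> x"
    using a_rcos_self[OF assms(2)] J.a_rcos_self[OF xc] by auto
  have "(\<Union>a'\<in>I +> a. \<Union>x'\<in>(I \<cdot> I) +> x. (I \<cdot> I) +> (a' \<otimes> x')) = (I \<cdot> I) +> (a \<otimes> x)" (is "?U = ?C")
  proof
    show "?U \<subseteq> ?C" using key by blast
    show "?C \<subseteq> ?U" using ne by blast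
  qed
  then show ?thesis by (simp add: conormal_module_def rcoset_mult_def)
qed

lemma (in ideal) conormal_module_is_module:
  assumes "cring R"
  shows "module (R Quot I) (conormal_module R I)"
proof -
  interpret cring R by fact
  have J: "ideal (I \<cdot> I) R" using ideal_prod_is_ideal[OF is_ideal is_ideal] .
  interpret J: ideal "I \<cdot> I" R by fact
  let ?M = "conormal_module R I"
  let ?c = "\<lambda>x. (I \<cdot> I) +> x"
  have cM: "carrier ?M = ?c ` I" by (simp add: conormal_module_def)
  have add: "?c x \<oplus>\<^bsub>?M\<^esub> ?c y = ?c (x \<oplus> y)" if "x \<in> I" "y \<in> I" for x y
    using that J.a_rcos_sum[of x y] by (simp add: conormal_module_def)
  have zero: "\<zero>\<^bsub>?M\<^esub> = ?c \<zero>" by (simp add: conormal_module_def a_coset_add_zero J.a_subset)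
  note sm = conormal_smult[OF assms]
  have qc: "carrier (R Quot I) = (\<lambda>a. I +> a) ` carrier R"
    by (auto simp: FactRing_def A_RCOSETS_def')
  have qadd: "(I +> a) \<oplus>\<^bsub>R Quot I\<^esub> (I +> b) = I +> (a \<oplus> b)" if "a \<in> carrier R" "b \<in> carrier R" for a b
    using that a_rcos_sum by (simp add: FactRing_def)
  have qmult: "(I +> a) \<otimes>\<^bsub>R Quot I\<^esub> (I +> b) = I +> (a \<otimes> b)" if "a \<in> carrier R" "b \<in> carrier R" for a b
    using that rcoset_mult_add by (simp add: FactRing_def)
  have qone: "\<one>\<^bsub>R Quot I\<^esub> = I +> \<one>" by (simp add: FactRing_def)
  have lift': "\<exists>x\<in>I. U = ?c x" if "U \<in> carrier ?M" for U
    using that by (auto simp: cM)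
  have ag: "abelian_group ?M"
  proof (rule abelian_groupI, goal_cases)
    case (1 u v)
    then obtain x y where "x \<in> I" "u = ?c x" "y \<in> I" "v = ?c y" using lift' by blast
    then show ?case by (simp add: add cM)
  next
    case 2
    show ?case by (simp add: zero cM)
  next
    case (3 u v w)
    from lift'[OF 3(1)] lift'[OF 3(2)] lift'[OF 3(3)]
    obtain x y z where "x \<in> I" "u = ?c x" "y \<in> I" "v = ?c y" "z \<in> I" "w = ?c z" by blast
    then show ?case by (simp add: add a_assoc)
  next
    case (4 u v)
    from lift'[OF 4(1)] lift'[OF 4(2)]
    obtain x y where xy: "x \<in> I" "u = ?c x" "y \<in> I" "v = ?c y" by blast
    then have "x \<oplus> y = y \<oplus> x" by (intro a_comm) auto
    then show ?case using xy by (simp add: add)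
  next
    case (5 u)
    from lift'[OF 5] obtain x where "x \<in> I" "u = ?c x" by blast
    then show ?case by (simp add: add zero)
  next
    case (6 u)
    from lift'[OF 6] obtain x where x: "x \<in> I" "u = ?c x" by blast
    then have "?c (\<ominus> x) \<oplus>\<^bsub>?M\<^esub> u = \<zero>\<^bsub>?M\<^esub>" by (simp add: add zero l_neg)
    moreover have "?c (\<ominus> x) \<in> carrier ?M" using x by (simp add: cM)
    ultimately show ?case by blast
  qed
  have lift: "\<exists>a\<in>carrier R. A = I +> a" if "A \<in> carrier (R Quot I)" for A
    using that by (auto simp: qc)
  note eqs = sm qadd qmult qone add I_l_closed Icarr
  show ?thesis
  proof (rule moduleI[OF quotient_is_cring[OF assms] ag], goal_cases)
    case (1 A U)
    from lift[OF 1(1)] lift'[OF 1(2)]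
    obtain a x where "a \<in> carrier R" "A = I +> a" "x \<in> I" "U = ?c x" by blast
    then show ?case by (simp add: cM eqs)
  next
    case (2 A B U)
    from lift[OF 2(1)] lift[OF 2(2)] lift'[OF 2(3)]
    obtain a b x where "a \<in> carrier R" "A = I +> a" "b \<in> carrier R" "B = I +> b" "x \<in> I" "U = ?c x" by blast
    then show ?case by (simp add: eqs l_distr)
  next
    case (3 A U V)
    from lift[OF 3(1)] lift'[OF 3(2)] lift'[OF 3(3)]
    obtain a x y where "a \<in> carrier R" "A = I +> a" "x \<in> I" "U = ?c x" "y \<in> I" "V = ?c y" by blast
    then show ?case by (simp add: eqs r_distr)
  next
    case (4 A B U)
    from lift[OF 4(1)] lift[OF 4(2)] lift'[OF 4(3)]
    obtain a b x where "a \<in> carrier R" "A = I +> a" "b \<in> carrier R" "B = I +> b" "x \<in> I" "U = ?c x" by blast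
    then show ?case by (simp add: eqs m_assoc)
  next
    case (5 U)
    then obtain x where "x \<in> I" "U = ?c x" using lift' by blast
    then show ?case by (simp add: eqs)
  qed
qed


definition max_ideal569 :: "'k::field fps set" where
  "max_ideal569 = {f \<in> carrier semigroup_ring569. fps_nth f 0 = 0}"

context
  fixes R :: "'k::field fps ring" (structure)
    and mm :: "'k fps set"
  defines R_def: "R \<equiv> semigroup_ring569" and mm_def: "mm \<equiv> max_ideal569"
begin

lemma ring569_simps:
  "x \<otimes> y = x * y" "x \<oplus> y = x + y" "\<one> = 1" "\<zero> = 0"
  by (auto simp: R_def semigroup_ring569_def)

lemma carrier569: "f \<in> carrier R \<longleftrightarrow> (\<forall>n. fps_nth f n \<noteq> 0 \<longrightarrow> n \<in> semigroup569)"
  by (auto simp: R_def semigroup_ring569_def)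

lemma zero_in_semigroup569: "0 \<in> semigroup569"
  by (auto simp: semigroup569_def)

lemma semigroup569_add:
  assumes "m \<in> semigroup569" "n \<in> semigroup569"
  shows "m + n \<in> semigroup569"
proof -
  obtain a b c a' b' c' where "m = 5 * a + 6 * b + 9 * c" "n = 5 * a' + 6 * b' + 9 * c'"
    using assms by (auto simp: semigroup569_def)
  then have "m + n = 5 * (a + a') + 6 * (b + b') + 9 * (c + c')" by simp
  then show ?thesis unfolding semigroup569_def by blast
qed

lemma semigroup569_conductor:
  assumes "n \<ge> 14"
  shows "n \<in> semigroup569"
proof -
  have "n mod 5 = 0 \<or> n mod 5 = 1 \<or> n mod 5 = 2 \<or> n mod 5 = 3 \<or> n mod 5 = 4" by presburger
  then obtain b c where bc: "n mod 5 = (6 * b + 9 * c) mod 5" "6 * b + 9 * c \<le> 18" "6 * b + 9 * c \<le> n"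
  proof (elim disjE)
    assume "n mod 5 = 0" with assms that[of 0 0] show ?thesis by simp
  next
    assume "n mod 5 = 1" with assms that[of 1 0] show ?thesis by simp
  next
    assume "n mod 5 = 2" with assms that[of 2 0] show ?thesis by simp
  next
    assume "n mod 5 = 3"
    moreover from this assms have "n \<ge> 18" by presburger
    ultimately show ?thesis using that[of 3 0] by simp
  next
    assume "n mod 5 = 4" with assms that[of 0 1] show ?thesis by simp
  qed
  then have "5 dvd n - (6 * b + 9 * c)" using mod_eq_dvd_iff_nat by metis
  then obtain a where "n - (6 * b + 9 * c) = 5 * a" by blast
  then have "n = 5 * a + 6 * b + 9 * c" using bc by simp
  then show ?thesis unfolding semigroup569_def by blast
qed

lemma carrier569I_high: "(\<And>n. n < 14 \<Longrightarrow> fps_nth f n = 0) \<Longrightarrow> f \<in> carrier R"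
  unfolding carrier569 using semigroup569_conductor by (meson not_le)

lemma carrier569_const: "fps_const c \<in> carrier R"
  by (auto simp: carrier569 zero_in_semigroup569)

lemma carrier569_uminus: "f \<in> carrier R \<Longrightarrow> - f \<in> carrier R"
  by (auto simp: carrier569)

lemma carrier569_add: "f \<in> carrier R \<Longrightarrow> g \<in> carrier R \<Longrightarrow> f + g \<in> carrier R"
  unfolding carrier569 by (metis add.right_neutral fps_add_nth)

lemma carrier569_mult:
  assumes "f \<in> carrier R" "g \<in> carrier R"
  shows "f * g \<in> carrier R"
  unfolding carrier569
proof (intro allI impI)
  fix n assume "fps_nth (f * g) n \<noteq> 0"
  then obtain i where i: "i \<le> n" "fps_nth f i * fps_nth g (n - i) \<noteq> 0"
    unfolding fps_mult_nth by (metis (no_types, lifting) atLeastAtMost_iff sum.neutral)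
  then have "i + (n - i) \<in> semigroup569"
    using assms by (intro semigroup569_add) (auto simp: carrier569)
  then show "n \<in> semigroup569" using i by simp
qed

lemma carrier569_inverse:
  assumes f: "f \<in> carrier R" and "fps_nth f 0 \<noteq> 0"
  shows "inverse f \<in> carrier R"
  unfolding carrier569
proof (intro allI impI)
  fix n show "fps_nth (inverse f) n \<noteq> 0 \<Longrightarrow> n \<in> semigroup569"
  proof (induction n rule: less_induct)
    case (less n)
    show ?case
    proof (cases "n = 0")
      case True then show ?thesis by (simp add: zero_in_semigroup569)
    next
      case False
      have "0 = fps_nth (inverse f * f) n" using assms False by (simp add: inverse_mult_eq_1)
      also have "\<dots> = (\<Sum>i\<in>insert n {0..<n}. fps_nth (inverse f) i * fps_nth f (n - i))"
        unfolding fps_mult_nth by (rule sum.cong) auto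
      also have "\<dots> = fps_nth (inverse f) n * fps_nth f 0
                   + (\<Sum>i=0..<n. fps_nth (inverse f) i * fps_nth f (n - i))"
        by (subst sum.insert) auto
      finally have "(\<Sum>i=0..<n. fps_nth (inverse f) i * fps_nth f (n - i)) \<noteq> 0"
        using less.prems assms(2) by (metis add.right_neutral mult_eq_0_iff)
      then obtain i where i: "i < n" "fps_nth (inverse f) i * fps_nth f (n - i) \<noteq> 0"
        by (metis (no_types, lifting) atLeastLessThan_iff sum.neutral)
      then have "i + (n - i) \<in> semigroup569"
        using less.IH f by (intro semigroup569_add) (auto simp: carrier569)
      then show ?thesis using i by simp
    qed
  qed
qed

lemma domain569: "domain R"
proof -
  have "cring R"
  proof (rule cringI)
    show "abelian_group R"
    proof (rule abelian_groupI)
      fix x assume "x \<in> carrier R"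
      then show "\<exists>y\<in>carrier R. y \<oplus> x = \<zero>"
        by (intro bexI[of _ "- x"]) (auto simp: ring569_simps carrier569_uminus)
    qed (use carrier569_const[of 0] in \<open>auto simp: ring569_simps carrier569_add algebra_simps\<close>)
    show "comm_monoid R"
      by (rule comm_monoidI)
         (auto simp: ring569_simps carrier569_mult algebra_simps carrier569_const[of 1, simplified])
  qed (auto simp: ring569_simps algebra_simps)
  then show ?thesis
    by (rule domainI) (auto simp: ring569_simps)
qed

lemma max569_def: "mm = {f \<in> carrier R. fps_nth f 0 = 0}"
  by (simp add: mm_def max_ideal569_def R_def)

interpretation domain R by (rule domain569)

lemma a_minus569: "x \<in> carrier R \<Longrightarrow> y \<in> carrier R \<Longrightarrow> x \<ominus> y = x - y"
proof -
  assume xy: "x \<in> carrier R" "y \<in> carrier R"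
  have "\<ominus> y = - y"
    using xy by (intro minus_equality) (auto simp: ring569_simps carrier569_uminus)
  then show ?thesis by (simp add: a_minus_def ring569_simps)
qed

lemma max569_ideal: "ideal mm R"
proof (rule idealI)
  show "subgroup mm (add_monoid R)"
  proof (rule add.subgroupI)
    fix a assume a: "a \<in> mm"
    then have "\<ominus> a = - a" using a_minus569[of 0 a] by (auto simp: max569_def a_minus_def ring569_simps carrier569)
    with a show "\<ominus> a \<in> mm" by (auto simp: max569_def carrier569_uminus)
  next
    show "mm \<noteq> {}" by (auto simp: max569_def carrier569 intro!: exI[of _ 0])
  qed (auto simp: max569_def ring569_simps carrier569_add)
qed (auto simp: max569_def ring569_simps carrier569_mult ring_axioms)

lemma proper_ideal569:
  assumes "ideal J R" "J \<noteq> carrier R"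
  shows "J \<subseteq> mm"
proof
  interpret J: ideal J R by fact
  fix f assume f: "f \<in> J"
  show "f \<in> mm"
  proof (rule ccontr)
    assume "f \<notin> mm"
    then have 0: "fps_nth f 0 \<noteq> 0" "f \<in> carrier R" using f by (auto simp: max569_def)
    then have "inverse f \<otimes> f \<in> J" by (intro J.I_l_closed f carrier569_inverse)
    then have "\<one> \<in> J" using 0 by (simp add: ring569_simps inverse_mult_eq_1)
    then show False using J.one_imp_carrier assms by simp
  qed
qed

lemma max569_proper: "mm \<noteq> carrier R"
proof
  assume "mm = carrier R"
  then have "1 \<in> mm" using carrier569_const[of 1] by simp
  then show False by (simp add: max569_def)
qed

lemma local569: "{J. maximalideal J R} = {mm}"
proof -
  have "maximalideal mm R"
  proof (rule maximalidealI)
    show "carrier R \<noteq> mm" using max569_proper by simp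
    show "J = mm \<or> J = carrier R" if "ideal J R" "mm \<subseteq> J" for J
      using proper_ideal569[OF that(1)] that(2) by blast
  qed (rule max569_ideal)
  moreover have "J = mm" if "maximalideal J R" for J
    using that proper_ideal569[of J] max569_ideal max569_proper
    by (metis maximalideal.I_maximal maximalideal.I_notcarr maximalideal.axioms(1) ideal.Icarr subsetI)
  ultimately show ?thesis by blast
qed

lemma multiples569:
  assumes g: "g \<in> carrier R" "g \<noteq> 0" and f: "\<And>n. n < subdegree g + 14 \<Longrightarrow> fps_nth f n = 0"
  shows "\<exists>h\<in>carrier R. f = h * g"
proof -
  have d: "f = g * (f div g)"
  proof (cases "f = 0")
    case False
    then have "subdegree g \<le> subdegree f" using f by (intro subdegree_geI) auto
    then have "g dvd f" using g(2) False by (simp add: fps_dvd_iff)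
    then show ?thesis by (rule dvd_mult_div_cancel[symmetric])
  qed simp
  have "f div g \<in> carrier R"
  proof (cases "f = 0")
    case False
    then have fg: "f div g \<noteq> 0" using d by auto
    have "subdegree f \<ge> subdegree g + 14" using f False by (intro subdegree_geI) auto
    moreover have "subdegree f = subdegree g + subdegree (f div g)"
      using d fg g(2) by (metis subdegree_mult)
    ultimately have "subdegree (f div g) \<ge> 14" by simp
    then show ?thesis by (intro carrier569I_high nth_less_subdegree_zero) simp
  qed (simp add: carrier569)
  then show ?thesis using d by (metis mult.commute)
qed

lemma noetherian569: "noetherian_ring R"
proof (rule noetherian_ringI)
  fix I assume I: "ideal I R"
  interpret I: ideal I R by fact
  show "\<exists>A\<subseteq>carrier R. finite A \<and> I = Idl A"
  proof (cases "I \<subseteq> {0}")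
    case True
    then have "I = {0}" using I.zero_closed by (auto simp: ring569_simps)
    then show ?thesis using genideal_zero
      by (intro exI[of _ "{0}"]) (auto simp: ring569_simps carrier569)
  next
    case False
    then obtain g where g: "g \<in> I" "g \<noteq> 0" by auto
    define N where "N = subdegree g + 14"
    define P where "P n h \<longleftrightarrow> h \<in> I \<and> h \<noteq> 0 \<and> subdegree h = n" for n h
    define w where "w n = (SOME h. P n h)" for n
    define G where "G = insert g (w ` {n. n < N \<and> (\<exists>h. P n h)})"
    have w: "P n (w n)" if "P n h" for n h
      unfolding w_def using that by (rule someI)
    have GI: "G \<subseteq> I" using g w by (auto simp: G_def P_def)
    then have Gc: "G \<subseteq> carrier R" using I.a_subset by blast
    have finG: "finite G" by (simp add: G_def)
    interpret G: ideal "Idl G" R by (rule genideal_ideal[OF Gc])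
    have GG: "x \<in> Idl G" if "x \<in> G" for x using genideal_self[OF Gc] that by blast
    have sub: "Idl G \<subseteq> I" using genideal_minimal[OF I GI] .
    have approx: "\<exists>h\<in>Idl G. \<forall>n<k. fps_nth (f - h) n = 0" if f: "f \<in> I" and "k \<le> N" for f k
      using that(2)
    proof (induction k)
      case 0 then show ?case using G.zero_closed by blast
    next
      case (Suc k)
      then obtain h where h: "h \<in> Idl G" "\<And>n. n < k \<Longrightarrow> fps_nth (f - h) n = 0" by auto
      show ?case
      proof (cases "fps_nth (f - h) k = 0")
        case True then show ?thesis using h by (auto simp: less_Suc_eq)
      next
        case False
        have hc: "h \<in> I" "h \<in> carrier R" "f \<in> carrier R" using h sub f by auto
        have sd: "subdegree (f - h) = k" using False h(2) by (intro subdegreeI) auto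
        have "f \<ominus> h \<in> I" unfolding a_minus_def using f hc by (intro I.a_closed I.a_inv_closed)
        then have "P k (f - h)" using False sd hc by (auto simp: P_def a_minus569)
        then have wk: "P k (w k)" and wG: "w k \<in> G" using w Suc.prems by (auto simp: G_def)
        define c where "c = fps_nth (f - h) k / fps_nth (w k) k"
        have wk': "w k \<noteq> 0" "subdegree (w k) = k" using wk unfolding P_def by blast+
        have w0: "fps_nth (w k) k \<noteq> 0"
          using nth_subdegree_nonzero[OF wk'(1)] unfolding wk'(2) .
        have w1: "fps_nth (w k) n = 0" if "n < k" for n
          using nth_less_subdegree_zero[of n "w k"] that unfolding wk'(2) .
        have "h \<oplus> (fps_const c \<otimes> w k) \<in> Idl G"
          by (intro G.a_closed[OF h(1)] G.I_l_closed GG wG carrier569_const)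
        moreover have "fps_nth (f - (h + fps_const c * w k)) n = 0" if "n < Suc k" for n
          using that h(2)[of n] w0 w1[of n] by (cases "n = k") (auto simp: c_def)
        ultimately show ?thesis unfolding ring569_simps by blast
      qed
    qed
    have "I \<subseteq> Idl G"
    proof
      fix f assume f: "f \<in> I"
      obtain h where h: "h \<in> Idl G" "\<And>n. n < N \<Longrightarrow> fps_nth (f - h) n = 0"
        using approx[OF f, of N] by auto
      have "g \<in> carrier R" using g by auto
      then obtain q where q: "q \<in> carrier R" "f - h = q * g"
        using multiples569[of g "f - h"] g h by (auto simp: N_def)
      have "h \<oplus> (q \<otimes> g) \<in> Idl G"
        using q by (intro G.a_closed[OF h(1)] G.I_l_closed GG) (auto simp: G_def)
      moreover have "h \<oplus> (q \<otimes> g) = f" by (simp add: ring569_simps q(2)[symmetric])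
      ultimately show "f \<in> Idl G" by simp
    qed
    then show ?thesis using sub Gc finG by blast
  qed
qed

lemma nonzero_prime569:
  assumes "primeideal P R" "P \<noteq> {0}"
  shows "P = mm"
proof -
  interpret P: primeideal P R by fact
  have PI: "ideal P R" by (rule P.is_ideal)
  obtain g where g: "g \<in> P" "g \<noteq> 0" using assms P.zero_closed by (auto simp: ring569_simps)
  have "x \<in> P" if x: "x \<in> mm" for x
  proof -
    have xc: "x \<in> carrier R" and x0: "fps_nth x 0 = 0" using x by (auto simp: max569_def)
    have "fps_nth (x ^ (subdegree g + 14)) n = 0" if "n < subdegree g + 14" for n
      using x0 that by (rule startsby_zero_power_prefix[rule_format, OF _ ])
    then obtain h where h: "h \<in> carrier R" "x ^ (subdegree g + 14) = h * g"
      using multiples569[of g] g P.Icarr by blast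
    then have mem: "x ^ (subdegree g + 14) \<in> P"
      using P.I_l_closed[OF g(1) h(1)] by (simp add: ring569_simps)
    have "x ^ m \<in> carrier R" for m
      by (induction m) (auto simp: carrier569_mult xc carrier569_const[of 1, simplified])
    then have "x ^ m \<in> P \<Longrightarrow> x \<in> P" for m
    proof (induction m)
      case 0
      then have "P = carrier R" using P.one_imp_carrier by (simp add: ring569_simps)
      then show ?case using xc by simp
    next
      case (Suc m)
      then show ?case using P.I_prime[of x "x ^ m"] xc by (auto simp: ring569_simps)
    qed
    then show ?thesis using mem by blast
  qed
  then show ?thesis using proper_ideal569[OF PI] P.I_notcarr by auto
qed

lemma monom569: "(fps_X ^ 5 :: 'k fps) \<in> mm"
proof -
  have "(5::nat) = 5 * 1 + 6 * 0 + 9 * 0" by simp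
  then have "5 \<in> semigroup569" unfolding semigroup569_def by blast
  then show ?thesis by (auto simp: max569_def carrier569)
qed

lemma krull_dim569: "krull_dim_eq R 1"
proof -
  have "maximalideal mm R" using local569 by blast
  then have prime: "primeideal mm R" by (rule maximalideal_prime)
  have "primeideal {0} R" using zeroprimeideal by (simp add: ring569_simps)
  moreover have "{0} \<subset> mm"
  proof -
    have "fps_X ^ 5 \<noteq> (0 :: 'k fps)" by simp
    moreover have "(0 :: 'k fps) \<in> mm" by (auto simp: max569_def carrier569)
    ultimately show ?thesis using monom569 by blast
  qed
  ultimately have "prime_chain R 1 (\<lambda>i. if i = 0 then {0} else mm)"
    using prime by (auto simp: prime_chain_def)
  moreover have "n \<le> 1" if P: "prime_chain R n P" for n P
  proof (rule ccontr)
    assume "\<not> n \<le> 1"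
    then have n: "2 \<le> n" by simp
    have pr: "primeideal (P i) R" if "i \<le> 2" for i using P n that by (auto simp: prime_chain_def)
    have "P 0 \<subset> P 1" using P n by (auto simp: prime_chain_def)
    have 12: "P 1 \<subset> P 2" using P n by (auto simp: prime_chain_def numeral_2_eq_2)
    have "0 \<in> P i" if "i \<le> 2" for i
    proof -
      interpret P: primeideal "P i" R using pr[OF that] .
      show ?thesis using P.zero_closed by (simp add: ring569_simps)
    qed
    then have "0 \<in> P 0" "0 \<in> P 1" by simp_all
    then have "P 1 \<noteq> {0}" "P 2 \<noteq> {0}" using \<open>P 0 \<subset> P 1\<close> 12 by auto
    then have "P 1 = mm" "P 2 = mm" using nonzero_prime569 pr by auto
    then show False using 12 by simp
  qed
  ultimately show ?thesis unfolding krull_dim_eq_def by blast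
qed

lemma cm_local_ring_dim1_569: "cm_local_ring_dim1 R mm"
proof -
  have "\<exists>x\<in>mm. \<forall>y\<in>carrier R. x \<otimes> y = \<zero> \<longrightarrow> y = \<zero>"
    using monom569 by (intro bexI[of _ "fps_X ^ 5"]) (auto simp: ring569_simps)
  then show ?thesis
    using noetherian569 local569 krull_dim569
    by (intro cm_local_ring_dim1.intro cm_local_ring_dim1_axioms.intro is_cring)
qed

end

theorem cm_local_ring_dim1_semigroup_ring569:
  "cm_local_ring_dim1 (semigroup_ring569 :: 'k::field fps ring) max_ideal569"
  by (rule cm_local_ring_dim1_569)

end

theory Submission
  imports Defs
begin

text \<open>
  Let \<open>A = k[[t\<^sup>5, t\<^sup>6, t\<^sup>9]]\<close>. The argument works with orders of power series. The semigroup
  \<open>\<langle>5, 6, 9\<rangle>\<close> has the gaps 1, 2, 3, 4, 7, 8, 13, so every series of order at least 14 is in \<open>A\<close>.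

  Let \<open>I\<close> be an Ulrich ideal with reduction \<open>(x)\<close>. From \<open>I\<^sup>2 = x I\<close> it follows that \<open>B = x\<^sup>-\<^sup>1 I\<close> is a
  ring between \<open>A\<close> and \<open>k[[t]]\<close>; it is not \<open>A\<close> since \<open>I\<close> is not \<open>(x)\<close>. Its value semigroup \<open>S\<close> thus
  properly contains \<open>\<langle>5, 6, 9\<rangle>\<close>, and \<open>e + S\<close> lies in \<open>\<langle>5, 6, 9\<rangle>\<close>, where \<open>e\<close> is the order of \<open>x\<close>. Freeness of
  \<open>I/I\<^sup>2\<close> over \<open>A/I\<close> implies for a minimal generator \<open>y\<close> of \<open>I\<close> that \<open>a y\<close> is in \<open>I\<^sup>2\<close> only if \<open>a\<close> is in \<open>I\<close>
  (\<open>free_conormal_nonzerodivisor\<close>). If \<open>y\<close> has order \<open>e + s\<close> with \<open>s\<close> a gap, an induction turns this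
  into the statement that \<open>I\<close> contains all elements of \<open>A\<close> of order at least \<open>14 - s\<close> (\<open>tail_in_ideal\<close>).
  So the larger the new elements of \<open>S\<close> are, the larger \<open>I\<close> is, and a finite case
  distinction leaves only \<open>e = 6\<close> and \<open>S = \<langle>3, 5\<rangle>\<close> (\<open>ulrich_values_569\<close>).

  Then \<open>I\<close> has elements of orders 6 and 9, none of order 10, and contains everything of order at
  least 11 in \<open>A\<close>. Normal forms for two generators are \<open>t\<^sup>6 + \<alpha> t\<^sup>1\<^sup>0\<close> and \<open>t\<^sup>9 + \<beta> t\<^sup>1\<^sup>0\<close>, and the ideal
  they generate consists of the elements \<open>f\<close> of \<open>A\<close> with \<open>f\<^sub>0 = f\<^sub>5 = 0\<close> and \<open>f\<^sub>1\<^sub>0 = \<alpha> f\<^sub>6 + \<beta> f\<^sub>9\<close>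
  (\<open>gen_ideal_eq\<close>), which shows that the parameters are determined by the ideal. The condition
  \<open>2 \<beta> = 0\<close> says exactly that the square of the second generator \<open>y\<close> is in \<open>x I\<close>: its term
  \<open>2 \<beta> t\<^sup>1\<^sup>9\<close> is the only obstruction. Conversely, when \<open>2 \<beta> = 0\<close>, the ideal is stable, and the classes of \<open>x\<close> and \<open>y\<close> are a basis of \<open>I/I\<^sup>2\<close> because
  \<open>b y\<close> cannot be a multiple of \<open>x\<close> for \<open>b\<close> of order 0, 5 or 10.
\<close>

section \<open>The conormal module in terms of representatives\<close>

context ideal
begin

lemma quotient_coset_simps:
  assumes "cring R"
  shows "carrier (R Quot I) = (\<lambda>a. I +> a) ` carrier R"
    and "\<zero>\<^bsub>R Quot I\<^esub> = I"
    and "\<lbrakk>a \<in> carrier R; b \<in> carrier R\<rbrakk> \<Longrightarrow> (I +> a) \<otimes>\<^bsub>R Quot I\<^esub> (I +> b) = I +> (a \<otimes> b)"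
    and "a \<in> carrier R \<Longrightarrow> I +> a = I \<longleftrightarrow> a \<in> I"
proof -
  interpret cring R by fact
  show "carrier (R Quot I) = (\<lambda>a. I +> a) ` carrier R"
    by (auto simp: FactRing_def A_RCOSETS_def')
  show "\<zero>\<^bsub>R Quot I\<^esub> = I" by (simp add: FactRing_def)
  show "\<lbrakk>a \<in> carrier R; b \<in> carrier R\<rbrakk> \<Longrightarrow> (I +> a) \<otimes>\<^bsub>R Quot I\<^esub> (I +> b) = I +> (a \<otimes> b)"
    using rcoset_mult_add by (simp add: FactRing_def)
  show "a \<in> carrier R \<Longrightarrow> I +> a = I \<longleftrightarrow> a \<in> I"
    using a_rcos_const a_rcos_self by metis
qed

lemma conormal_coset_simps:
  assumes "cring R"
  shows "carrier (conormal_module R I) = (\<lambda>x. (I \<cdot> I) +> x) ` I"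
    and "\<zero>\<^bsub>conormal_module R I\<^esub> = I \<cdot> I"
    and "\<lbrakk>x \<in> I; y \<in> I\<rbrakk> \<Longrightarrow>
      ((I \<cdot> I) +> x) \<oplus>\<^bsub>conormal_module R I\<^esub> ((I \<cdot> I) +> y) = (I \<cdot> I) +> (x \<oplus> y)"
    and "\<lbrakk>x \<in> I; y \<in> I\<rbrakk> \<Longrightarrow> (I \<cdot> I) +> x = (I \<cdot> I) +> y \<longleftrightarrow> x \<ominus> y \<in> I \<cdot> I"
    and "x \<in> I \<Longrightarrow> (I \<cdot> I) +> x = I \<cdot> I \<longleftrightarrow> x \<in> I \<cdot> I"
proof -
  interpret cring R by fact
  have J: "ideal (I \<cdot> I) R" using ideal_prod_is_ideal[OF is_ideal is_ideal] .
  interpret J: ideal "I \<cdot> I" R by fact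
  show "carrier (conormal_module R I) = (\<lambda>x. (I \<cdot> I) +> x) ` I"
    and "\<zero>\<^bsub>conormal_module R I\<^esub> = I \<cdot> I"
    by (simp_all add: conormal_module_def)
  show "\<lbrakk>x \<in> I; y \<in> I\<rbrakk> \<Longrightarrow>
      ((I \<cdot> I) +> x) \<oplus>\<^bsub>conormal_module R I\<^esub> ((I \<cdot> I) +> y) = (I \<cdot> I) +> (x \<oplus> y)"
    using J.a_rcos_sum[of x y] by (simp add: conormal_module_def)
  show "\<lbrakk>x \<in> I; y \<in> I\<rbrakk> \<Longrightarrow> (I \<cdot> I) +> x = (I \<cdot> I) +> y \<longleftrightarrow> x \<ominus> y \<in> I \<cdot> I"
    using quotient_eq_iff_same_a_r_cos[OF J, of x y] by auto
  show "x \<in> I \<Longrightarrow> (I \<cdot> I) +> x = I \<cdot> I \<longleftrightarrow> x \<in> I \<cdot> I"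
    using J.quotient_coset_simps(4)[OF assms] by auto
qed

text \<open>A minimal generator \<open>y\<close> of \<open>I\<close> has a unit among its coordinates with respect to a basis of
\<open>I/I\<^sup>2\<close>, so only zero in \<open>R/I\<close> can annihilate its class.
In this form freeness enters the classification.\<close>

lemma free_conormal_nonzerodivisor:
  assumes R: "cring R" and free: "free_module (R Quot I) (conormal_module R I)"
    and m: "ideal \<mm> R" "I \<subseteq> \<mm>" and units: "\<And>u. \<lbrakk>u \<in> carrier R; u \<notin> \<mm>\<rbrakk> \<Longrightarrow> u \<in> Units R"
    and y: "y \<in> I" "y \<notin> \<mm> \<cdot> I" and a: "a \<in> carrier R" "a \<otimes> y \<in> I \<cdot> I"
  shows "a \<in> I"
proof -
  interpret cring R by fact
  interpret m: ideal \<mm> R by (rule m(1))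
  let ?M = "conormal_module R I"
  let ?c = "\<lambda>x. (I \<cdot> I) +> x"
  interpret M: module "R Quot I" ?M by (rule conormal_module_is_module[OF R])
  have zI: "\<zero> \<in> I" by (rule additive_subgroup.zero_closed[OF is_additive_subgroup])
  interpret II: ideal "I \<cdot> I" R by (rule ideal_prod_is_ideal[OF is_ideal is_ideal])
  interpret mI: ideal "\<mm> \<cdot> I" R by (rule ideal_prod_is_ideal[OF m(1) is_ideal])
  note q = quotient_coset_simps[OF R] and c = conormal_coset_simps[OF R]
  obtain B where B: "module_basis (R Quot I) ?M B" using free by (auto simp: free_module_def)
  have "?c y \<in> carrier ?M" using y by (simp add: c)
  then have "\<exists>F k. finite F \<and> F \<subseteq> B \<and> k \<in> F \<rightarrow> carrier (R Quot I) \<and>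
      ?c y = finsum ?M (\<lambda>b. k b \<odot>\<^bsub>?M\<^esub> b) F"
    by (rule B[unfolded module_basis_def, THEN conjunct2, THEN conjunct1, THEN bspec])
  then obtain F k where F: "finite F" "F \<subseteq> B" "k \<in> F \<rightarrow> carrier (R Quot I)"
    and yF: "?c y = finsum ?M (\<lambda>b. k b \<odot>\<^bsub>?M\<^esub> b) F"
    by (elim exE conjE) (rule that)
  have FM: "F \<subseteq> carrier ?M" using B F by (auto simp: module_basis_def)
  have mI_I: "\<mm> \<cdot> I \<subseteq> I" using ideal_prod_inter[OF m(1) is_ideal] by blast
  \<comment> \<open>Otherwise all the coordinates of \<open>y\<close> would lie in the maximal ideal and \<open>y\<close> would be in \<open>\<mm> I\<close>.\<close>
  have "\<exists>b\<in>F. k b \<notin> (\<lambda>a. I +> a) ` \<mm>"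
  proof (rule ccontr)
    assume contra: "\<not> ?thesis"
    have "\<exists>w\<in>\<mm> \<cdot> I. finsum ?M (\<lambda>b. k b \<odot>\<^bsub>?M\<^esub> b) G = ?c w" if "finite G" "G \<subseteq> F" for G
      using that
    proof (induction G rule: finite_induct)
      case empty
      have "?c \<zero> = I \<cdot> I" using c(5)[OF zI] II.zero_closed by blast
      then have "finsum ?M (\<lambda>b. k b \<odot>\<^bsub>?M\<^esub> b) {} = ?c \<zero>" by (simp add: c(2))
      then show ?case using mI.zero_closed by blast
    next
      case (insert b G)
      then obtain w where w: "w \<in> \<mm> \<cdot> I" "finsum ?M (\<lambda>b. k b \<odot>\<^bsub>?M\<^esub> b) G = ?c w" by auto
      obtain u where u: "u \<in> \<mm>" "k b = I +> u" using contra insert by auto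
      obtain x where x: "x \<in> I" "b = ?c x" using FM insert by (auto simp: c)
      have "k b \<odot>\<^bsub>?M\<^esub> b = ?c (u \<otimes> x)" using u x conormal_smult[OF R] by auto
      moreover have ux: "u \<otimes> x \<in> \<mm> \<cdot> I" using u x by (intro ideal_prod.prod)
      moreover have "(\<lambda>b. k b \<odot>\<^bsub>?M\<^esub> b) \<in> G \<rightarrow> carrier ?M" "k b \<odot>\<^bsub>?M\<^esub> b \<in> carrier ?M"
        using insert F FM by (auto intro!: M.smult_closed)
      ultimately have "finsum ?M (\<lambda>b. k b \<odot>\<^bsub>?M\<^esub> b) (insert b G) = ?c (u \<otimes> x) \<oplus>\<^bsub>?M\<^esub> ?c w"
        using insert.hyps w(2) by (simp add: M.finsum_insert)
      also have "\<dots> = ?c ((u \<otimes> x) \<oplus> w)" using ux w mI_I by (intro c(3)) auto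
      finally show ?case using ux w by blast
    qed
    from this[OF F(1) order.refl] obtain w where w: "w \<in> \<mm> \<cdot> I" "?c y = ?c w"
      unfolding yF by blast
    then have "y \<ominus> w \<in> I \<cdot> I" using y mI_I by (subst c(4)[symmetric]) auto
    moreover have "I \<cdot> I \<subseteq> \<mm> \<cdot> I"
    proof
      fix z assume "z \<in> I \<cdot> I" then show "z \<in> \<mm> \<cdot> I"
        by (induction rule: ideal_prod.induct) (use m in \<open>auto intro: ideal_prod.intros\<close>)
    qed
    ultimately have "(y \<ominus> w) \<oplus> w \<in> \<mm> \<cdot> I" using w by blast
    moreover have "(y \<ominus> w) \<oplus> w = y"
      using y mI.Icarr[OF w(1)] Icarr by (simp add: a_minus_def a_assoc l_neg)
    ultimately show False using y by simp
  qed
  then obtain b where b0: "b \<in> F" "k b \<notin> (\<lambda>a. I +> a) ` \<mm>" by blast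
  moreover have "k b \<in> (\<lambda>a. I +> a) ` carrier R" using F(3) b0(1) unfolding q(1) by blast
  ultimately obtain u where b: "b \<in> F" "u \<in> carrier R" "k b = I +> u" "u \<notin> \<mm>" by blast
  have smul: "(\<lambda>b. k b \<odot>\<^bsub>?M\<^esub> b) \<in> F \<rightarrow> carrier ?M"
    using F FM by (auto intro!: M.smult_closed)
  have qa: "I +> a \<in> carrier (R Quot I)" using a by (simp add: q)
  have "?c (a \<otimes> y) = I \<cdot> I" using a y by (simp add: c I_l_closed)
  then have "\<zero>\<^bsub>?M\<^esub> = (I +> a) \<odot>\<^bsub>?M\<^esub> ?c y"
    using conormal_smult[OF R a(1) y(1)] by (simp add: c)
  also have "\<dots> = finsum ?M (\<lambda>b. (I +> a) \<odot>\<^bsub>?M\<^esub> (k b \<odot>\<^bsub>?M\<^esub> b)) F"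
    unfolding yF using F smul qa by (intro M.finsum_smult_ldistr) auto
  also have "\<dots> = finsum ?M (\<lambda>b. ((I +> a) \<otimes>\<^bsub>R Quot I\<^esub> k b) \<odot>\<^bsub>?M\<^esub> b) F"
  proof (rule M.finsum_cong'[OF refl])
    show "(\<lambda>b. ((I +> a) \<otimes>\<^bsub>R Quot I\<^esub> k b) \<odot>\<^bsub>?M\<^esub> b) \<in> F \<rightarrow> carrier ?M"
      using F(3) FM qa by (auto intro!: M.smult_closed)
    show "(I +> a) \<odot>\<^bsub>?M\<^esub> (k b \<odot>\<^bsub>?M\<^esub> b) = ((I +> a) \<otimes>\<^bsub>R Quot I\<^esub> k b) \<odot>\<^bsub>?M\<^esub> b" if "b \<in> F" for b
      using that F(3) FM qa by (intro M.smult_assoc1[symmetric]) auto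
  qed
  finally have "finsum ?M (\<lambda>b. ((I +> a) \<otimes>\<^bsub>R Quot I\<^esub> k b) \<odot>\<^bsub>?M\<^esub> b) F = \<zero>\<^bsub>?M\<^esub>" by simp
  moreover have "(\<lambda>b. (I +> a) \<otimes>\<^bsub>R Quot I\<^esub> k b) \<in> F \<rightarrow> carrier (R Quot I)"
    using F qa by auto
  ultimately have "\<forall>b\<in>F. (I +> a) \<otimes>\<^bsub>R Quot I\<^esub> k b = \<zero>\<^bsub>R Quot I\<^esub>"
    using F(1,2) by (intro B[unfolded module_basis_def, THEN conjunct2, THEN conjunct2, THEN spec,
      THEN spec, THEN mp] conjI)
  then have "(I +> a) \<otimes>\<^bsub>R Quot I\<^esub> k b = \<zero>\<^bsub>R Quot I\<^esub>" using b(1) by blast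
  then have "a \<otimes> u \<in> I" using a b by (simp add: q)
  moreover have "u \<in> Units R" using units b by blast
  ultimately have "(a \<otimes> u) \<otimes> inv u \<in> I" by (metis I_r_closed Units_inv_closed)
  then show ?thesis using a b \<open>u \<in> Units R\<close> by (simp add: m_assoc)
qed

text \<open>The converse tool: the classes of two elements form a basis as soon as they generate \<open>I\<close> and the
only relations between them modulo \<open>I\<^sup>2\<close> are the trivial ones.\<close>

lemma free_conormal_two_generators:
  assumes R: "cring R" and proper: "I \<noteq> carrier R" and x: "x \<in> I" and y: "y \<in> I"
    and gen: "\<And>f. f \<in> I \<Longrightarrow> \<exists>a\<in>carrier R. \<exists>b\<in>carrier R. f = a \<otimes> x \<oplus> b \<otimes> y"
    and indep: "\<And>a b. \<lbrakk>a \<in> carrier R; b \<in> carrier R; a \<otimes> x \<oplus> b \<otimes> y \<in> I \<cdot> I\<rbrakk> \<Longrightarrow> a \<in> I \<and> b \<in> I"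
  shows "free_module (R Quot I) (conormal_module R I)"
proof -
  interpret cring R by fact
  let ?M = "conormal_module R I"
  let ?c = "\<lambda>x. (I \<cdot> I) +> x"
  interpret M: module "R Quot I" ?M by (rule conormal_module_is_module[OF R])
  have zI: "\<zero> \<in> I" by (rule additive_subgroup.zero_closed[OF is_additive_subgroup])
  interpret II: ideal "I \<cdot> I" R by (rule ideal_prod_is_ideal[OF is_ideal is_ideal])
  note q = quotient_coset_simps[OF R] and c = conormal_coset_simps[OF R]
  note sm = conormal_smult[OF R]
  have xy: "x \<in> carrier R" "y \<in> carrier R" using x y by auto
  have cM: "?c x \<in> carrier ?M" "?c y \<in> carrier ?M" using x y by (auto simp: c)
  have ne: "?c x \<noteq> ?c y"
  proof
    assume "?c x = ?c y"
    then have "x \<ominus> y \<in> I \<cdot> I" using c(4) x y by simp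
    moreover have "x \<ominus> y = \<one> \<otimes> x \<oplus> (\<ominus> \<one>) \<otimes> y" using xy by (simp add: l_minus a_minus_def)
    ultimately have "\<one> \<in> I" using indep[of \<one> "\<ominus> \<one>"] by simp
    then show False using proper one_imp_carrier by simp
  qed
  have comb: "finsum ?M (\<lambda>b. k b \<odot>\<^bsub>?M\<^esub> b) {?c x, ?c y} = ?c (u \<otimes> x \<oplus> v \<otimes> y)"
    if "u \<in> carrier R" "v \<in> carrier R" "k (?c x) = I +> u" "k (?c y) = I +> v" for k u v
  proof -
    have "finsum ?M (\<lambda>b. k b \<odot>\<^bsub>?M\<^esub> b) {?c x, ?c y} = ?c (u \<otimes> x) \<oplus>\<^bsub>?M\<^esub> ?c (v \<otimes> y)"
    proof (subst M.finsum_insert)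
      have "k (?c y) \<odot>\<^bsub>?M\<^esub> ?c y = ?c (v \<otimes> y)" "k (?c x) \<odot>\<^bsub>?M\<^esub> ?c x = ?c (u \<otimes> x)"
        using that x y sm by simp_all
      moreover have "?c (v \<otimes> y) \<in> carrier ?M" "?c (u \<otimes> x) \<in> carrier ?M"
        using that x y by (auto simp: c(1) I_l_closed)
      ultimately show "(k (?c x) \<odot>\<^bsub>?M\<^esub> ?c x) \<oplus>\<^bsub>?M\<^esub> finsum ?M (\<lambda>b. k b \<odot>\<^bsub>?M\<^esub> b) {?c y} =
          ?c (u \<otimes> x) \<oplus>\<^bsub>?M\<^esub> ?c (v \<otimes> y)"
        "(\<lambda>b. k b \<odot>\<^bsub>?M\<^esub> b) \<in> {?c y} \<rightarrow> carrier ?M" "k (?c x) \<odot>\<^bsub>?M\<^esub> ?c x \<in> carrier ?M"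
        by simp_all
    qed (use ne in auto)
    then show ?thesis using that x y by (simp add: c I_l_closed)
  qed
  have "module_basis (R Quot I) ?M {?c x, ?c y}"
    unfolding module_basis_def
  proof (intro conjI ballI allI impI)
    show "{?c x, ?c y} \<subseteq> carrier ?M" using cM by simp
  next
    fix U assume "U \<in> carrier ?M"
    then obtain f where f: "f \<in> I" "U = ?c f" by (auto simp: c)
    obtain a b where ab: "a \<in> carrier R" "b \<in> carrier R" "f = a \<otimes> x \<oplus> b \<otimes> y" using gen[OF f(1)] by blast
    let ?k = "\<lambda>V. if V = ?c x then I +> a else I +> b"
    have "finsum ?M (\<lambda>b. ?k b \<odot>\<^bsub>?M\<^esub> b) {?c x, ?c y} = U"
      using comb[of a b ?k] ab f ne by simp
    moreover have "?k \<in> {?c x, ?c y} \<rightarrow> carrier (R Quot I)" using ab by (auto simp: q)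
    ultimately show "\<exists>F k. finite F \<and> F \<subseteq> {?c x, ?c y} \<and> k \<in> F \<rightarrow> carrier (R Quot I) \<and>
        U = finsum ?M (\<lambda>b. k b \<odot>\<^bsub>?M\<^esub> b) F"
      by (intro exI[of _ "{?c x, ?c y}"] exI[of _ ?k]) auto
  next
    fix F k b
    assume H: "finite F \<and> F \<subseteq> {?c x, ?c y} \<and> k \<in> F \<rightarrow> carrier (R Quot I) \<and>
        finsum ?M (\<lambda>b. k b \<odot>\<^bsub>?M\<^esub> b) F = \<zero>\<^bsub>?M\<^esub>" and b: "b \<in> F"
    \<comment> \<open>Extending the coefficients by zero replaces an arbitrary subset \<open>F\<close> by the full pair.\<close>
    define k' where "k' V = (if V \<in> F then k V else I +> \<zero>)" for V
    have z: "(I +> \<zero>) \<odot>\<^bsub>?M\<^esub> ?c w = \<zero>\<^bsub>?M\<^esub>" if "w \<in> I" for w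
    proof -
      have "(I +> \<zero>) \<odot>\<^bsub>?M\<^esub> ?c w = ?c \<zero>" using sm[of \<zero> w] that Icarr[OF that] by simp
      also have "\<dots> = \<zero>\<^bsub>?M\<^esub>" using c(5)[OF zI] II.zero_closed c(2) by blast
      finally show ?thesis .
    qed
    have k'c: "k' V \<in> carrier (R Quot I)" for V using H by (auto simp: k'_def q)
    have "finsum ?M (\<lambda>b. k b \<odot>\<^bsub>?M\<^esub> b) F = finsum ?M (\<lambda>b. k' b \<odot>\<^bsub>?M\<^esub> b) {?c x, ?c y}"
    proof (rule M.add.finprod_mono_neutral_cong_left)
      show "k' i \<odot>\<^bsub>?M\<^esub> i = \<zero>\<^bsub>?M\<^esub>" if "i \<in> {?c x, ?c y} - F" for i
        using that z x y by (auto simp: k'_def)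
      show "(\<lambda>b. k' b \<odot>\<^bsub>?M\<^esub> b) \<in> {?c x, ?c y} \<rightarrow> carrier ?M"
        using k'c cM by (auto intro!: M.smult_closed)
    qed (use H in \<open>auto simp: k'_def\<close>)
    moreover obtain u v where uv: "u \<in> carrier R" "v \<in> carrier R"
        "k' (?c x) = I +> u" "k' (?c y) = I +> v"
      using k'c[of "?c x"] k'c[of "?c y"] by (auto simp: q)
    ultimately have "?c (u \<otimes> x \<oplus> v \<otimes> y) = I \<cdot> I" using comb[OF uv] H by (simp add: c)
    then have "u \<otimes> x \<oplus> v \<otimes> y \<in> I \<cdot> I" using uv x y by (simp add: c I_l_closed)
    then have "u \<in> I" "v \<in> I" using indep[OF uv(1,2)] by blast+
    then have "I +> u = I" "I +> v = I" using q(4) uv(1,2) by blast+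
    then have "k' b = I" using b H uv(3,4) by auto
    then show "k b = \<zero>\<^bsub>R Quot I\<^esub>" using b by (simp add: k'_def q)
  qed
  then show ?thesis using M.module_axioms by (auto simp: free_module_def)
qed

end

lemma (in cring) principal_ideal_prod:
  assumes x: "x \<in> carrier R" and I: "ideal I R"
  shows "(Idl {x}) \<cdot> I = (\<lambda>z. x \<otimes> z) ` I"
proof -
  interpret I: ideal I R by fact
  have Q: "Idl {x} = {r \<otimes> x | r. r \<in> carrier R}"
    using cgenideal_eq_genideal[OF x] by (simp add: cgenideal_def)
  show ?thesis
  proof
    show "(Idl {x}) \<cdot> I \<subseteq> (\<lambda>z. x \<otimes> z) ` I"
    proof
      fix s assume "s \<in> (Idl {x}) \<cdot> I"
      then show "s \<in> (\<lambda>z. x \<otimes> z) ` I"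
      proof (induction rule: ideal_prod.induct)
        case (prod i j)
        then obtain r where r: "r \<in> carrier R" "i = r \<otimes> x" by (auto simp: Q)
        then have "i \<otimes> j = x \<otimes> (r \<otimes> j)" using x prod I.Icarr by (simp add: m_ac)
        then show ?case using r prod I.I_l_closed by blast
      next
        case (sum s t)
        then obtain u v where "u \<in> I" "v \<in> I" "s = x \<otimes> u" "t = x \<otimes> v" by blast
        then have "s \<oplus> t = x \<otimes> (u \<oplus> v)" "u \<oplus> v \<in> I" using x I.Icarr by (simp_all add: r_distr)
        then show ?case by blast
      qed
    qed
    show "(\<lambda>z. x \<otimes> z) ` I \<subseteq> (Idl {x}) \<cdot> I"
      using genideal_self'[OF x] by (auto intro: ideal_prod.prod)
  qed
qed

section \<open>Possible orders of elements of an Ulrich ideal\<close>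

lemma mem_semigroup569_iff:
  "n \<in> semigroup569 \<longleftrightarrow> n \<in> {0, 5, 6, 9, 10, 11, 12} \<or> 14 \<le> n"
proof
  assume "n \<in> semigroup569"
  then obtain a b c where n: "n = 5 * a + 6 * b + 9 * c" by (auto simp: semigroup569_def)
  show "n \<in> {0, 5, 6, 9, 10, 11, 12} \<or> 14 \<le> n"
  proof (rule ccontr)
    assume contra: "\<not> ?thesis"
    then have "a = 0 \<or> a = 1 \<or> a = 2" "b = 0 \<or> b = 1 \<or> b = 2" "c = 0 \<or> c = 1" using n by auto
    then show False using contra n by auto
  qed
next
  assume "n \<in> {0, 5, 6, 9, 10, 11, 12} \<or> 14 \<le> n"
  moreover have "0 = 5 * 0 + 6 * 0 + 9 * (0::nat)" "5 = 5 * 1 + 6 * 0 + 9 * (0::nat)"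
    "6 = 5 * 0 + 6 * 1 + 9 * (0::nat)" "9 = 5 * 0 + 6 * 0 + 9 * (1::nat)"
    "10 = 5 * 2 + 6 * 0 + 9 * (0::nat)" "11 = 5 * 1 + 6 * 1 + 9 * (0::nat)"
    "12 = 5 * 0 + 6 * 2 + 9 * (0::nat)" by simp_all
  ultimately show "n \<in> semigroup569"
    using semigroup569_conductor[of n] unfolding semigroup569_def by blast
qed

text \<open>Here \<open>E\<close> stands for the set of orders of the elements of a hypothetical Ulrich ideal and
\<open>e + s\<close> in \<open>E\<close> means that \<open>s\<close> is in the value semigroup \<open>S\<close> of the ring \<open>x\<^sup>-\<^sup>1 I\<close>. The assumption
\<open>cond\<close> is the numerical shadow of freeness (lemma \<open>tail_in_ideal\<close> below). It forces \<open>E\<close> to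
contain almost everything above some bound, which keeps \<open>e\<close> small, and then every semigroup
\<open>S\<close> except the one generated by 3 and 5 leads to an element of \<open>E\<close> that is a gap of
\<open>\<langle>5, 6, 9\<rangle>\<close> or to an element of \<open>E\<close> whose distance from \<open>e\<close> is not in \<open>S\<close>.\<close>

lemma ulrich_values_569:
  fixes E :: "nat set" and e :: nat
  assumes e: "e \<in> E" "\<And>n. n \<in> E \<Longrightarrow> e \<le> n" and pos: "0 < e"
    and sub: "\<And>n. n \<in> E \<Longrightarrow> n \<in> semigroup569"
    and mult: "\<And>i j. e + i \<in> E \<Longrightarrow> e + j \<in> E \<Longrightarrow> e + (i + j) \<in> E"
    and nonprincipal: "\<exists>s. s \<notin> semigroup569 \<and> e + s \<in> E"
    and cond: "\<And>s n. \<lbrakk>s \<notin> semigroup569; e + s \<in> E;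
        \<And>r. r \<notin> semigroup569 \<Longrightarrow> e + r \<in> E \<Longrightarrow> s < r + 5;
        n \<in> semigroup569; 14 \<le> n + s\<rbrakk> \<Longrightarrow> n \<in> E"
  shows "e = 6 \<and> 9 \<in> E \<and> 10 \<notin> E"
proof -
  note H = mem_semigroup569_iff
  have gap: "r \<in> {1, 2, 3, 4, 7, 8, 13}" if "r \<notin> semigroup569" for r
    using that unfolding H insert_iff empty_iff by presburger
  have notE: "7 \<notin> E" "8 \<notin> E" "13 \<notin> E" using sub[of 7] sub[of 8] sub[of 13] by (auto simp: H)
  \<comment> \<open>For \<open>s \<le> 4\<close> the minimality condition in \<open>cond\<close> is void.\<close>
  have small: "n \<in> E" if "s \<in> {1, 2, 3, 4}" "e + s \<in> E" "n \<in> semigroup569" "14 \<le> n + s" for s n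
    using that by (intro cond[of s n]) (auto simp: H)
  have e_mem: "e \<in> {5, 6, 9, 10, 11, 12} \<or> 14 \<le> e" using sub[OF e(1)] pos by (auto simp: H)
  show ?thesis
  proof (cases "e + 4 \<in> E")
    case True
    have E: "10 \<in> E" "11 \<in> E" "12 \<in> E" "14 \<in> E" using small[of 4] True by (auto simp: H)
    have "e + 8 \<in> E" using mult[of 4 4] True by simp
    consider "e = 5" | "e = 6" | "e = 9" | "e = 10" using e_mem e(2)[OF E(1)] by auto
    then show ?thesis
    proof cases
      case 1 then show ?thesis using \<open>e + 8 \<in> E\<close> notE by simp
    next
      case 2
      \<comment> \<open>\<open>S\<close> would be generated by 4, 5, 6; the element 8 of \<open>S\<close>, although twice 4, belongs to a
        further generator of \<open>I\<close>, and freeness applied to it gives the contradiction.\<close>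
      have no3: "9 \<notin> E" using mult[of 4 3] 2 True notE by auto
      have "9 \<in> E"
      proof (rule cond[of 8])
        show "8 < r + 5" if "r \<notin> semigroup569" "e + r \<in> E" for r
        proof -
          have "6 + r \<in> E" using that(2) 2 by simp
          then have "r \<noteq> 1" "r \<noteq> 2" "r \<noteq> 3" using notE no3 by auto
          then show ?thesis using gap[OF that(1)] by auto
        qed
      qed (use \<open>e + 8 \<in> E\<close> in \<open>auto simp: H\<close>)
      then show ?thesis using no3 by simp
    next
      case 3 then show ?thesis using True notE by simp
    next
      case 4
      then have "e + 3 \<in> E" using mult[of 1 2] mult[of 1 1] E by simp
      then show ?thesis using 4 notE by simp
    qed
  next
    case no4: False
    then have no12: "e + 1 \<notin> E" "e + 2 \<notin> E" using mult[of 2 2] mult[of 1 1] by auto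
    show ?thesis
    proof (cases "e + 3 \<in> E")
      case True
      have E: "11 \<in> E" "12 \<in> E" "14 \<in> E" using small[of 3] True by (auto simp: H)
      consider "e = 5" | "e = 6" | "e = 9" | "e = 10" | "e = 11" using e_mem e(2)[OF E(1)] by auto
      then show ?thesis
      proof cases
        case 1 then show ?thesis using True notE by simp
      next
        case 2 then show ?thesis using True no4 by simp
      qed (use E no12 in simp_all)
    next
      case no3: False
      have large: "7 \<le> r" if "r \<notin> semigroup569" "e + r \<in> E" for r
      proof -
        have "r \<noteq> 1" "r \<noteq> 2" "r \<noteq> 3" "r \<noteq> 4" using that(2) no12 no3 no4 by auto
        then show ?thesis using gap[OF that(1)] by auto
      qed
      define s where "s = (LEAST s. s \<notin> semigroup569 \<and> e + s \<in> E)"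
      have s: "s \<notin> semigroup569" "e + s \<in> E" using LeastI_ex[OF nonprincipal] by (auto simp: s_def)
      have least: "s \<le> r" if "r \<notin> semigroup569" "e + r \<in> E" for r
        unfolding s_def using that by (intro Least_le) auto
      have "n \<in> E" if "n \<in> {9, 10}" for n
        using that large[OF s] least by (intro cond[OF s]) (force simp: H)+
      then have E: "9 \<in> E" "10 \<in> E" by auto
      consider "e = 5" | "e = 6" | "e = 9" using e_mem e(2)[OF E(1)] by auto
      then show ?thesis using E no3 no4 no12 by cases simp_all
    qed
  qed
qed

section \<open>Orders of series in the semigroup ring\<close>

abbreviation S569 :: "'k::field fps ring" where "S569 \<equiv> semigroup_ring569"

lemma
  assumes "ideal I S569"
  shows ideal569_carrier: "f \<in> I \<Longrightarrow> f \<in> carrier S569"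
    and ideal569_zero: "0 \<in> I"
    and ideal569_add: "f \<in> I \<Longrightarrow> g \<in> I \<Longrightarrow> f + g \<in> I"
    and ideal569_diff: "f \<in> I \<Longrightarrow> g \<in> I \<Longrightarrow> f - g \<in> I"
    and ideal569_mult: "a \<in> carrier S569 \<Longrightarrow> f \<in> I \<Longrightarrow> a * f \<in> I"
    and ideal569_scale: "f \<in> I \<Longrightarrow> fps_const c * f \<in> I"
proof -
  interpret domain S569 by (rule domain569)
  interpret I: ideal I S569 by fact
  show carr: "f \<in> I \<Longrightarrow> f \<in> carrier S569" for f by (rule I.Icarr)
  show "0 \<in> I" using I.zero_closed by (simp add: ring569_simps)
  show add: "f \<in> I \<Longrightarrow> g \<in> I \<Longrightarrow> f + g \<in> I" for f g
    using I.a_closed[of f g] by (simp add: ring569_simps)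
  show mult: "a \<in> carrier S569 \<Longrightarrow> f \<in> I \<Longrightarrow> a * f \<in> I" for a f
    using I.I_l_closed[of f a] by (simp add: ring569_simps)
  show scale: "f \<in> I \<Longrightarrow> fps_const c * f \<in> I" for c f
    using mult[OF carrier569_const] .
  show "f \<in> I \<Longrightarrow> g \<in> I \<Longrightarrow> f - g \<in> I"
    using add[OF _ scale[of g "-1"], of f] by (simp flip: fps_const_neg)
qed

lemma ideal569I:
  assumes "I \<subseteq> carrier S569" "0 \<in> I" "\<And>f g. f \<in> I \<Longrightarrow> g \<in> I \<Longrightarrow> f + g \<in> I"
    and "\<And>a f. a \<in> carrier S569 \<Longrightarrow> f \<in> I \<Longrightarrow> a * f \<in> I"
  shows "ideal I S569"
proof -
  interpret domain S569 by (rule domain569)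
  have neg: "- f \<in> I" if "f \<in> I" for f
    using assms(4)[OF carrier569_const[of "-1"] that] by (simp flip: fps_const_neg)
  show ?thesis
  proof (rule idealI)
    show "subgroup I (add_monoid S569)"
    proof (rule add.subgroupI)
      fix f assume f: "f \<in> I"
      then have "\<ominus>\<^bsub>S569\<^esub> f = - f"
        using a_minus569[of 0 f] assms(1) carrier569_const[of 0]
        by (auto simp: a_minus_def ring569_simps)
      then show "\<ominus>\<^bsub>S569\<^esub> f \<in> I" using neg[OF f] by simp
    qed (use assms in \<open>auto simp: ring569_simps\<close>)
    show "f \<otimes>\<^bsub>S569\<^esub> a \<in> I" if "f \<in> I" "a \<in> carrier S569" for a f
      using assms(4)[OF that(2,1)] by (simp add: ring569_simps mult.commute)
  qed (use assms ring_axioms in \<open>auto simp: ring569_simps\<close>)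
qed

lemma principal569:
  assumes "x \<in> carrier S569"
  shows "Idl\<^bsub>S569\<^esub> {x} = (\<lambda>a. x * a) ` carrier S569"
proof -
  interpret domain S569 by (rule domain569)
  have "Idl\<^bsub>S569\<^esub> {x} = {a * x | a. a \<in> carrier S569}"
    using cgenideal_eq_genideal[OF assms] by (simp add: cgenideal_def ring569_simps)
  then show ?thesis by (auto simp: mult.commute)
qed

lemma principal_prod569:
  assumes "x \<in> carrier S569" "ideal I S569"
  shows "(Idl\<^bsub>S569\<^esub> {x}) \<cdot>\<^bsub>S569\<^esub> I = (\<lambda>z. x * z) ` I"
proof -
  interpret domain S569 by (rule domain569)
  show ?thesis using principal_ideal_prod[OF assms] by (simp add: ring569_simps)
qed

lemma monom569_iff: "fps_X ^ n \<in> carrier (S569 :: 'k::field fps ring) \<longleftrightarrow> n \<in> semigroup569"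
  by (auto simp: carrier569)

text \<open>The ideal \<open>t\<^sup>N k[[t]]\<close>. Membership in it is used instead of a lower bound on the subdegree, because the
subdegree of the zero series is 0.\<close>

definition fps_tail :: "nat \<Rightarrow> 'a::zero fps set" where
  "fps_tail N = {f. \<forall>n<N. fps_nth f n = 0}"

definition fps_values :: "'a::zero fps set \<Rightarrow> nat set" where
  "fps_values F = subdegree ` (F - {0})"

lemma fps_tail_iff: "f \<in> fps_tail N \<longleftrightarrow> f = 0 \<or> N \<le> subdegree f"
proof
  assume "f \<in> fps_tail N" then show "f = 0 \<or> N \<le> subdegree f"
    by (auto simp: fps_tail_def intro: subdegree_geI)
qed (auto simp: fps_tail_def intro: nth_less_subdegree_zero)

lemma fps_tail_mono: "f \<in> fps_tail N \<Longrightarrow> M \<le> N \<Longrightarrow> f \<in> fps_tail M"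
  by (auto simp: fps_tail_def)

lemma fps_tail_add:
  "f \<in> fps_tail N \<Longrightarrow> g \<in> fps_tail N \<Longrightarrow> f + g \<in> fps_tail N" for f :: "'a::monoid_add fps"
  by (auto simp: fps_tail_def)

lemma fps_tail_mult:
  "f \<in> fps_tail M \<Longrightarrow> g \<in> fps_tail N \<Longrightarrow> f * g \<in> fps_tail (M + N)" for f :: "'a::idom fps"
  by (cases "f = 0"; cases "g = 0") (auto simp: fps_tail_iff)

lemma fps_tail_cancel:
  "f * g \<in> fps_tail (subdegree f + N) \<Longrightarrow> f \<noteq> 0 \<Longrightarrow> g \<in> fps_tail N" for f :: "'a::idom fps"
  by (cases "f = 0"; cases "g = 0") (auto simp: fps_tail_iff)

lemma max569_tail: "f \<in> max_ideal569 \<Longrightarrow> f \<in> fps_tail 5"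
proof -
  assume "f \<in> max_ideal569"
  then have "n \<in> semigroup569" "n \<noteq> 0" if "fps_nth f n \<noteq> 0" for n
    using that by (auto simp: max569_def carrier569 intro: gr0I)
  then show ?thesis by (force simp: fps_tail_def mem_semigroup569_iff)
qed

text \<open>Fourteen is the conductor of the semigroup, so a quotient of order at least 14 lies in the ring.\<close>

lemma tail_multiple569:
  assumes "g \<in> carrier S569" "g \<noteq> 0" "f \<in> fps_tail (subdegree g + 14)"
  obtains h where "h \<in> carrier S569" "f = g * h"
  using multiples569[of g f] assms by (auto simp: fps_tail_def mult.commute)

lemma fps_valuesI: "f \<in> F \<Longrightarrow> f \<noteq> 0 \<Longrightarrow> subdegree f = n \<Longrightarrow> n \<in> fps_values F"
  by (auto simp: fps_values_def)

lemma fps_valuesE: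
  assumes "n \<in> fps_values F"
  obtains f where "f \<in> F" "f \<noteq> 0" "subdegree f = n"
  using assms by (auto simp: fps_values_def)

lemma fps_values569: "F \<subseteq> carrier S569 \<Longrightarrow> n \<in> fps_values F \<Longrightarrow> n \<in> semigroup569"
  unfolding fps_values_def using carrier569 nth_subdegree_nonzero by blast

lemma fps_values_action569:
  assumes I: "ideal I S569" and "n \<in> fps_values I" "h \<in> semigroup569"
  shows "n + h \<in> fps_values I"
proof -
  obtain f where f: "f \<in> I" "f \<noteq> 0" "subdegree f = n" using assms by (auto simp: fps_values_def)
  then show ?thesis using assms(3)
    by (intro fps_valuesI[of "fps_X ^ h * f"] ideal569_mult[OF I]) (auto simp: monom569_iff)
qed

text \<open>Subtracting suitable multiples of elements of \<open>G\<close> cancels the leading terms of \<open>f\<close> one after the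
other, as long as every order that may occur in \<open>F\<close> is also the order of an element of \<open>G\<close>.
Comparisons of ideals reduce in this way to comparisons of sets of orders.\<close>

lemma approximate_by_values:
  fixes F G :: "'a::field fps set"
  assumes G: "0 \<in> G" "\<And>f g. f \<in> G \<Longrightarrow> g \<in> G \<Longrightarrow> f + g \<in> G" "\<And>c f. f \<in> G \<Longrightarrow> fps_const c * f \<in> G"
    and F: "\<And>f g. f \<in> F \<Longrightarrow> g \<in> G \<Longrightarrow> f - g \<in> F"
    and vals: "\<And>n. N \<le> n \<Longrightarrow> n < M \<Longrightarrow> n \<in> fps_values F \<Longrightarrow> n \<in> fps_values G"
    and f: "f \<in> F" "f \<in> fps_tail N"
  shows "\<exists>g\<in>G. f - g \<in> fps_tail M"
  using vals
proof (induction M)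
  case 0
  then show ?case using G(1) by (auto simp: fps_tail_def)
next
  case (Suc M)
  then obtain g where g: "g \<in> G" "f - g \<in> fps_tail M" by auto
  show ?case
  proof (cases "M < N \<or> fps_nth (f - g) M = 0")
    case True
    then show ?thesis
    proof
      assume "M < N"
      then have "f - 0 \<in> fps_tail (Suc M)" using fps_tail_mono[OF f(2)] by simp
      then show ?thesis using G(1) by blast
    next
      assume "fps_nth (f - g) M = 0"
      then have "f - g \<in> fps_tail (Suc M)" using g(2) by (auto simp: fps_tail_def less_Suc_eq)
      then show ?thesis using g(1) by blast
    qed
  next
    case False
    then have "subdegree (f - g) = M" using g(2) by (intro subdegreeI) (auto simp: fps_tail_def)
    then have "M \<in> fps_values F" using False F[OF f(1) g(1)] by (intro fps_valuesI[of "f - g"]) auto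
    then have "M \<in> fps_values G" using Suc.prems False by simp
    then obtain h where h: "h \<in> G" "h \<noteq> 0" "subdegree h = M" by (auto simp: fps_values_def)
    define c where "c = fps_nth (f - g) M / fps_nth h M"
    have hM: "fps_nth h M \<noteq> 0" using h nth_subdegree_nonzero by metis
    have h0: "fps_nth h n = 0" if "n < M" for n using nth_less_subdegree_zero[of n h] h(3) that by simp
    have "fps_nth (f - (g + fps_const c * h)) n = 0" if "n < Suc M" for n
      using that g(2) h0[of n] hM by (cases "n = M") (auto simp: c_def fps_tail_def)
    then have "f - (g + fps_const c * h) \<in> fps_tail (Suc M)" by (simp add: fps_tail_def)
    then show ?thesis using g(1) h(1) G by blast
  qed
qed

section \<open>Freeness determines the set of orders\<close>

text \<open>The data of an Ulrich ideal with reduction \<open>(x)\<close>, in the form in which it is used. Because of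
\<open>I\<^sup>2 = x I\<close> the set \<open>x\<^sup>-\<^sup>1 I\<close> is a ring between \<open>k[[t\<^sup>5, t\<^sup>6, t\<^sup>9]]\<close> and \<open>k[[t]]\<close>, and it is strictly larger
than the former because \<open>I\<close> is not \<open>(x)\<close>. Below, \<open>E\<close> is the set of orders of elements of \<open>I\<close> and
\<open>e\<close> is the order of \<open>x\<close>, so that \<open>E - e\<close> is the value semigroup of this ring.\<close>

locale ulrich569 =
  fixes I :: "'k::field fps set" and x :: "'k fps"
  assumes ideal: "ideal I S569" and in_max: "I \<subseteq> max_ideal569"
    and x: "x \<in> I" "x \<noteq> 0"
    and stable: "I \<cdot>\<^bsub>S569\<^esub> I = (\<lambda>z. x * z) ` I"
    and nonprincipal: "I \<noteq> (\<lambda>a. x * a) ` carrier S569"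
    and free: "free_module (S569 Quot I) (conormal_module S569 I)"
begin

abbreviation "E \<equiv> fps_values I"
abbreviation "e \<equiv> subdegree x"

lemmas carrier = ideal569_carrier[OF ideal]

lemma mult_in: "f \<in> I \<Longrightarrow> g \<in> I \<Longrightarrow> \<exists>z\<in>I. f * g = x * z"
  using ideal_prod.prod[of f I g I S569] unfolding stable by (auto simp: ring569_simps)

lemma prod_in: "z \<in> I \<Longrightarrow> x * z \<in> I \<cdot>\<^bsub>S569\<^esub> I"
  unfolding stable by blast

lemma e_mem: "e \<in> E"
  using x by (intro fps_valuesI) auto

text \<open>If \<open>f\<close> has minimal order \<open>m\<close> in \<open>I\<close> then \<open>f\<^sup>2 = x z\<close> with \<open>z\<close> in \<open>I\<close>, whence \<open>2 m \<ge> e + m\<close>.\<close>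

lemma e_le: "n \<in> E \<Longrightarrow> e \<le> n"
proof -
  define m where "m = (LEAST m. m \<in> E)"
  have "m \<in> E" unfolding m_def using e_mem by (rule LeastI)
  then obtain f where f: "f \<in> I" "f \<noteq> 0" "subdegree f = m" by (auto simp: fps_values_def)
  obtain z where z: "z \<in> I" "f * f = x * z" using mult_in[OF f(1,1)] by blast
  have z0: "z \<noteq> 0" using z f by auto
  then have "m \<le> subdegree z" unfolding m_def using z(1) by (intro Least_le fps_valuesI[of z]) auto
  moreover have "m + m = e + subdegree z"
    using arg_cong[OF z(2), of subdegree] f x z0 by simp
  moreover assume "n \<in> E" then have "m \<le> n" unfolding m_def by (rule Least_le)
  ultimately show ?thesis by simp
qed

lemma e_pos: "0 < e"
  using in_max x max569_tail[of x] by (force simp: fps_tail_iff)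

lemma values_add:
  assumes "e + i \<in> E" "e + j \<in> E"
  shows "e + (i + j) \<in> E"
proof -
  obtain f g where fg: "f \<in> I" "f \<noteq> 0" "subdegree f = e + i" "g \<in> I" "g \<noteq> 0" "subdegree g = e + j"
    using assms by (elim fps_valuesE) (rule that)
  obtain z where z: "z \<in> I" "f * g = x * z" using mult_in fg by blast
  have z0: "z \<noteq> 0" using z fg by auto
  have "subdegree z = e + (i + j)" using arg_cong[OF z(2), of subdegree] fg x z0 by simp
  then show ?thesis using z z0 by (intro fps_valuesI)
qed

lemma values_principal:
  "n \<in> fps_values ((\<lambda>a. x * a) ` carrier S569) \<longleftrightarrow> e \<le> n \<and> n - e \<in> semigroup569"
proof
  assume "n \<in> fps_values ((\<lambda>a. x * a) ` carrier S569)"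
  then obtain a where a: "a \<in> carrier S569" "x * a \<noteq> 0" "n = subdegree (x * a)"
    by (elim fps_valuesE) auto
  then have "subdegree a \<in> semigroup569"
    by (intro fps_values569[of "carrier (S569 :: 'k fps ring)", OF order.refl] fps_valuesI[of a]) auto
  then show "e \<le> n \<and> n - e \<in> semigroup569" using a x by simp
next
  assume "e \<le> n \<and> n - e \<in> semigroup569"
  then show "n \<in> fps_values ((\<lambda>a. x * a) ` carrier S569)"
    using x by (intro fps_valuesI[of "x * fps_X ^ (n - e)"]) (auto simp: monom569_iff)
qed

lemma approximate_multiple:
  assumes f: "f \<in> I" and vals: "\<And>n. n < M \<Longrightarrow> n \<in> E \<Longrightarrow> n - e \<in> semigroup569"
  shows "\<exists>a\<in>carrier S569. f - x * a \<in> fps_tail M"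
proof -
  have "\<exists>g\<in>(\<lambda>a. x * a) ` carrier S569. f - g \<in> fps_tail M"
  proof (rule approximate_by_values[where N = 0, OF _ _ _ _ _ f])
    show "0 \<in> (\<lambda>a. x * a) ` carrier S569" using carrier569_const[of 0] by force
    show "g + h \<in> (\<lambda>a. x * a) ` carrier S569"
      if "g \<in> (\<lambda>a. x * a) ` carrier S569" "h \<in> (\<lambda>a. x * a) ` carrier S569" for g h
      using that by (auto simp: carrier569_add simp flip: distrib_left)
    show "fps_const c * g \<in> (\<lambda>a. x * a) ` carrier S569"
      if "g \<in> (\<lambda>a. x * a) ` carrier S569" for c g
      using that by (auto simp: carrier569_mult carrier569_const mult.left_commute)
    show "g - h \<in> I" if "g \<in> I" "h \<in> (\<lambda>a. x * a) ` carrier S569" for g h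
      using that x by (auto simp: mult.commute[of x] intro!: ideal569_diff[OF ideal] ideal569_mult[OF ideal])
    show "n \<in> fps_values ((\<lambda>a. x * a) ` carrier S569)" if "n < M" "n \<in> E" for n
      using vals[OF that] e_le[OF that(2)] by (simp add: values_principal)
  qed (simp add: fps_tail_def)
  then show ?thesis by blast
qed

lemma nonprincipal_value: "\<exists>s. s \<notin> semigroup569 \<and> e + s \<in> E"
proof (rule ccontr)
  assume contra: "\<not> ?thesis"
  then have vals: "n - e \<in> semigroup569" if "n \<in> E" for n
    using that e_le[OF that] by (metis le_add_diff_inverse)
  have "I \<subseteq> (\<lambda>a. x * a) ` carrier S569"
  proof
    fix f assume "f \<in> I"
    then obtain a where a: "a \<in> carrier S569" "f - x * a \<in> fps_tail (e + 14)"
      using approximate_multiple[of f "e + 14"] vals by blast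
    obtain h where "h \<in> carrier S569" "f - x * a = x * h"
      using tail_multiple569[OF carrier[OF x(1)] x(2) a(2)] .
    then have "f = x * (a + h)" "a + h \<in> carrier S569"
      using a by (auto simp: algebra_simps carrier569_add)
    then show "f \<in> (\<lambda>a. x * a) ` carrier S569" by blast
  qed
  moreover have "(\<lambda>a. x * a) ` carrier S569 \<subseteq> I"
    using ideal569_mult[OF ideal _ x(1)] by (auto simp: mult.commute[of x])
  ultimately show False using nonprincipal by blast
qed

text \<open>Let \<open>r\<close> be the least gap of \<open>\<langle>5, 6, 9\<rangle>\<close> with \<open>e + r\<close> in \<open>E\<close>. Modulo multiples of \<open>x\<close>, elements of
\<open>I\<close> have order at least \<open>e + r\<close>, and therefore elements of \<open>\<mm> I\<close> have order at least \<open>e + r + 5\<close>.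
An element of smaller order \<open>e + s\<close> in \<open>\<mm> I\<close> would have the order of a multiple
of \<open>x\<close>, so that \<open>s\<close> would not be a gap.\<close>

lemma not_in_max_prod:
  assumes y: "y \<noteq> 0" "subdegree y = e + s" "s \<notin> semigroup569"
    and gap: "\<And>r. r \<notin> semigroup569 \<Longrightarrow> e + r \<in> E \<Longrightarrow> s < r + 5"
  shows "y \<notin> max_ideal569 \<cdot>\<^bsub>S569\<^esub> I"
proof
  have xc: "x \<in> carrier S569" using x carrier by simp
  have approx: "\<exists>a\<in>carrier S569. f - x * a \<in> fps_tail (e + s - 4)" if f: "f \<in> I" for f
  proof (rule approximate_multiple[OF f])
    fix n assume n: "n < e + s - 4" "n \<in> E"
    then have "e + (n - e) \<in> E" using e_le by simp
    moreover have "\<not> s < (n - e) + 5" using n(1) e_le[OF n(2)] by simp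
    ultimately show "n - e \<in> semigroup569" using gap by blast
  qed
  have "\<exists>a\<in>carrier S569. w - x * a \<in> fps_tail (e + s + 1)" if "w \<in> max_ideal569 \<cdot>\<^bsub>S569\<^esub> I" for w
    using that
  proof (induction rule: ideal_prod.induct)
    case (prod m f)
    obtain a where a: "a \<in> carrier S569" "f - x * a \<in> fps_tail (e + s - 4)" using approx prod by blast
    have "m * (f - x * a) \<in> fps_tail (5 + (e + s - 4))"
      using prod a by (intro fps_tail_mult max569_tail)
    then have "m * (f - x * a) \<in> fps_tail (e + s + 1)" by (rule fps_tail_mono) simp
    moreover have "m * (f - x * a) = m \<otimes>\<^bsub>S569\<^esub> f - x * (m * a)"
      by (simp add: ring569_simps algebra_simps)
    moreover have "m * a \<in> carrier S569" using prod a by (intro carrier569_mult) (auto simp: max569_def)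
    ultimately show ?case by metis
  next
    case (sum u v)
    then obtain a b where "a \<in> carrier S569" "u - x * a \<in> fps_tail (e + s + 1)"
      "b \<in> carrier S569" "v - x * b \<in> fps_tail (e + s + 1)" by blast
    then have "(u - x * a) + (v - x * b) \<in> fps_tail (e + s + 1)" "a + b \<in> carrier S569"
      by (auto intro: fps_tail_add carrier569_add)
    moreover have "(u - x * a) + (v - x * b) = u \<oplus>\<^bsub>S569\<^esub> v - x * (a + b)"
      by (simp add: ring569_simps algebra_simps)
    ultimately show ?case by metis
  qed
  moreover assume "y \<in> max_ideal569 \<cdot>\<^bsub>S569\<^esub> I"
  ultimately obtain a where a: "a \<in> carrier S569" "y - x * a \<in> fps_tail (e + s + 1)" by blast
  have eq: "fps_nth y n = fps_nth (x * a) n" if "n \<le> e + s" for n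
    using a(2) that by (auto simp: fps_tail_def)
  have "subdegree (x * a) = e + s"
  proof (rule subdegreeI)
    show "fps_nth (x * a) (e + s) \<noteq> 0"
      using eq[of "e + s"] nth_subdegree_nonzero[OF y(1)] unfolding y(2) by simp
    show "fps_nth (x * a) n = 0" if "n < e + s" for n
      using eq[of n] that y nth_less_subdegree_zero[of n y] by simp
  qed
  moreover have "x * a \<noteq> 0"
    using eq[of "e + s"] nth_subdegree_nonzero[OF y(1)] unfolding y(2) by auto
  ultimately have "e + s \<in> fps_values ((\<lambda>a. x * a) ` carrier S569)" using a by (intro fps_valuesI[of "x * a"]) auto
  then show False using y(3) by (simp add: values_principal)
qed

text \<open>Let \<open>y\<close> be a minimal generator of \<open>I\<close> of order \<open>e + s\<close>. If the order of \<open>a\<close> is at least \<open>14 - s\<close>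
then \<open>c = a y / x\<close> has order at least 14 and so lies in the ring, and its order exceeds that of \<open>a\<close>
by \<open>s > 0\<close>. By downward induction on the order, starting from multiples of \<open>x\<close>, the element \<open>c\<close>
is in \<open>I\<close>; then \<open>a y = x c\<close> is in \<open>x I = I\<^sup>2\<close> and freeness gives that \<open>a\<close> is in \<open>I\<close>.\<close>

lemma tail_in_ideal:
  assumes s: "s \<notin> semigroup569" "e + s \<in> E"
    and gap: "\<And>r. r \<notin> semigroup569 \<Longrightarrow> e + r \<in> E \<Longrightarrow> s < r + 5"
    and a: "a \<in> carrier S569" "a \<in> fps_tail (14 - s)"
  shows "a \<in> I"
proof -
  interpret domain S569 by (rule domain569)
  interpret I: ideal I S569 by (rule ideal)
  have R: "cring S569" by (rule is_cring)
  have xc: "x \<in> carrier S569" using x carrier by simp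
  have s_pos: "0 < s" "s < 14" using s(1) by (auto simp: mem_semigroup569_iff intro: gr0I)
  obtain y where y: "y \<in> I" "y \<noteq> 0" "subdegree y = e + s" using s(2) by (rule fps_valuesE)
  have nonzerodivisor: "b \<in> I" if b: "b \<in> carrier S569" "b * y \<in> I \<cdot>\<^bsub>S569\<^esub> I" for b
  proof (rule I.free_conormal_nonzerodivisor[OF R free max569_ideal in_max _ y(1)])
    show "y \<notin> max_ideal569 \<cdot>\<^bsub>S569\<^esub> I" using not_in_max_prod[OF y(2,3) s(1) gap] .
    show "u \<in> Units S569" if u: "u \<in> carrier S569" "u \<notin> max_ideal569" for u
    proof -
      have u0: "fps_nth u 0 \<noteq> 0" using u by (simp add: max569_def)
      then have "inverse u \<in> carrier S569" "inverse u * u = 1" "u * inverse u = 1"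
        using carrier569_inverse[OF u(1)] by (auto simp: inverse_mult_eq_1 inverse_mult_eq_1')
      then show ?thesis using u by (auto simp: Units_def ring569_simps)
    qed
  qed (use b in \<open>auto simp: ring569_simps\<close>)
  have "14 - s \<le> e + 14" by simp
  then have "\<forall>b\<in>carrier S569 \<inter> fps_tail (14 - s). b \<in> I"
  proof (induction rule: inc_induct)
    case base
    show ?case
    proof
      fix b :: "'k fps" assume b: "b \<in> carrier S569 \<inter> fps_tail (e + 14)"
      then obtain h where "h \<in> carrier S569" "b = x * h" using tail_multiple569[OF xc x(2), of b] by blast
      then show "b \<in> I" using ideal569_mult[OF ideal, of h x] x by (simp add: mult.commute)
    qed
  next
    case (step n)
    show ?case
    proof
      fix b :: "'k fps" assume b: "b \<in> carrier S569 \<inter> fps_tail n"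
      have by_tail: "b * y \<in> fps_tail (n + (e + s))"
        using b y by (intro fps_tail_mult) (auto simp: fps_tail_iff)
      then have "b * y \<in> fps_tail (e + 14)" by (rule fps_tail_mono) (use step(1) in simp)
      then obtain c where c: "c \<in> carrier S569" "b * y = x * c"
        using tail_multiple569[OF xc x(2), of "b * y"] by blast
      have "x * c \<in> fps_tail (e + Suc n)"
        using by_tail unfolding c(2) by (rule fps_tail_mono) (use s_pos in simp)
      then have "c \<in> fps_tail (Suc n)" using x(2) by (rule fps_tail_cancel)
      then have "c \<in> I" using step.IH c by blast
      then have "b * y \<in> I \<cdot>\<^bsub>S569\<^esub> I" using prod_in unfolding c(2) by blast
      then show "b \<in> I" using nonzerodivisor b by blast
    qed
  qed
  then show ?thesis using a by blast
qed

lemma values_eq: "e = 6 \<and> 9 \<in> E \<and> 10 \<notin> E"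
proof (rule ulrich_values_569)
  show "n \<in> E"
    if "s \<notin> semigroup569" "e + s \<in> E" "\<And>r. r \<notin> semigroup569 \<Longrightarrow> e + r \<in> E \<Longrightarrow> s < r + 5"
      "n \<in> semigroup569" "14 \<le> n + s" for s n
    using tail_in_ideal[OF that(1-3), of "fps_X ^ n"] that(4,5)
    by (intro fps_valuesI[of "fps_X ^ n"]) (auto simp: monom569_iff fps_tail_iff)
  show "n \<in> semigroup569" if "n \<in> E" for n
    using fps_values569[OF _ that] carrier by blast
qed (fact e_mem e_le e_pos values_add nonprincipal_value)+

lemma tail11: "a \<in> carrier S569 \<Longrightarrow> a \<in> fps_tail 11 \<Longrightarrow> a \<in> I"
  using tail_in_ideal[of 3 a] values_eq by (auto simp: mem_semigroup569_iff)

end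

section \<open>The two-parameter family of ideals\<close>

definition gen6 :: "'k::field \<Rightarrow> 'k fps" where
  "gen6 \<alpha> = fps_X ^ 6 + fps_const \<alpha> * fps_X ^ 10"

definition gen9 :: "'k::field \<Rightarrow> 'k fps" where
  "gen9 \<beta> = fps_X ^ 9 + fps_const \<beta> * fps_X ^ 10"

abbreviation gen_ideal :: "'k::field \<Rightarrow> 'k \<Rightarrow> 'k fps set" where
  "gen_ideal \<alpha> \<beta> \<equiv> Idl\<^bsub>S569\<^esub> {gen6 \<alpha>, gen9 \<beta>}"

lemma gen_nth [simp]:
  "fps_nth (gen6 \<alpha>) n = (if n = 6 then 1 else if n = 10 then \<alpha> else 0)"
  "fps_nth (gen9 \<beta>) n = (if n = 9 then 1 else if n = 10 then \<beta> else 0)"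
  by (auto simp: gen6_def gen9_def)

lemma gen_carrier: "gen6 \<alpha> \<in> carrier S569" "gen9 \<beta> \<in> carrier S569"
  unfolding carrier569 gen_nth by (auto simp: mem_semigroup569_iff)

lemma subdegree_gen: "subdegree (gen6 \<alpha>) = 6" "subdegree (gen9 \<beta>) = 9"
  by (rule subdegreeI; simp)+

lemma gen_nonzero: "gen6 \<alpha> \<noteq> 0" "gen9 \<beta> \<noteq> 0"
  using subdegree_gen[of \<alpha>] subdegree_gen[of \<beta>] by (metis subdegree_0 zero_neq_numeral)+

lemma gen_square:
  "gen6 \<alpha> * gen6 \<alpha> = fps_X ^ 12 + fps_const (2 * \<alpha>) * fps_X ^ 16 + fps_const (\<alpha> * \<alpha>) * fps_X ^ 20"
  "gen9 \<beta> * gen9 \<beta> = fps_X ^ 18 + fps_const (2 * \<beta>) * fps_X ^ 19 + fps_const (\<beta> * \<beta>) * fps_X ^ 20"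
  by (simp_all add: gen6_def gen9_def algebra_simps numeral_fps_const flip: power_add fps_const_mult fps_const_add)

lemma ideal_gen_ideal: "ideal (gen_ideal \<alpha> \<beta>) S569"
  and gen_mem: "gen6 \<alpha> \<in> gen_ideal \<alpha> \<beta>" "gen9 \<beta> \<in> gen_ideal \<alpha> \<beta>"
proof -
  interpret domain S569 by (rule domain569)
  have sub: "{gen6 \<alpha>, gen9 \<beta>} \<subseteq> carrier S569" using gen_carrier by blast
  show "ideal (gen_ideal \<alpha> \<beta>) S569" by (rule genideal_ideal[OF sub])
  show "gen6 \<alpha> \<in> gen_ideal \<alpha> \<beta>" "gen9 \<beta> \<in> gen_ideal \<alpha> \<beta>" using genideal_self[OF sub] by blast+
qed

lemma carrier569_gap: "f \<in> carrier S569 \<Longrightarrow> n \<in> {1, 2, 3, 4, 7, 8, 13} \<Longrightarrow> fps_nth f n = 0"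
  using carrier569[of f] mem_semigroup569_iff[of n] by auto

lemma tail11_569:
  assumes "f \<in> carrier S569" "\<And>n. n \<in> {0, 5, 6, 9, 10} \<Longrightarrow> fps_nth f n = 0"
  shows "f \<in> fps_tail 11"
  unfolding fps_tail_def
proof (intro CollectI allI impI)
  fix n :: nat assume "n < 11"
  then have "n \<in> {1, 2, 3, 4, 7, 8, 13} \<or> n \<in> {0, 5, 6, 9, 10}"
    unfolding insert_iff empty_iff by presburger
  then show "fps_nth f n = 0" using assms(2) carrier569_gap[OF assms(1)] by blast
qed

text \<open>The orders 6 and 9 of the generators already produce all elements of the semigroup from 11 to 19, and
everything of order at least 20 is a multiple of the first generator.\<close>

lemma tail_subset_gen_ideal:
  assumes "f \<in> carrier S569" "f \<in> fps_tail 11"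
  shows "f \<in> gen_ideal \<alpha> \<beta>"
proof -
  let ?J = "gen_ideal \<alpha> \<beta>"
  note J = ideal_gen_ideal[of \<alpha> \<beta>]
  have "\<exists>g\<in>?J. f - g \<in> fps_tail 20"
  proof (rule approximate_by_values[where N = 11, OF _ _ _ _ _ assms])
    show "f - g \<in> carrier S569" if "f \<in> carrier S569" "g \<in> ?J" for f g
      using carrier569_add[OF that(1) carrier569_uminus[OF ideal569_carrier[OF J that(2)]]] by simp
    fix n :: nat assume n: "11 \<le> n" "n < 20" "n \<in> fps_values (carrier (S569 :: 'a fps ring))"
    have "n \<in> semigroup569" using fps_values569[OF order.refl n(3)] .
    then have "n = 6 + 5 \<or> n = 6 + 6 \<or> n = 9 + 5 \<or> n = 6 + 9 \<or> n = 6 + 10 \<or> n = 6 + 11 \<or> n = 6 + 12 \<or> n = 9 + 10"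
      using n(1,2) unfolding mem_semigroup569_iff insert_iff empty_iff by presburger
    then obtain m h where mh: "m \<in> {6, 9}" "h \<in> {5, 6, 9, 10, 11, 12}" "n = m + h" by blast
    have "6 \<in> fps_values ?J" "9 \<in> fps_values ?J"
      using gen_mem gen_nonzero subdegree_gen by (intro fps_valuesI; blast)+
    moreover have "h \<in> semigroup569" if "h \<in> {5, 6, 9, 10, 11, 12}" for h
      using that by (auto simp: mem_semigroup569_iff)
    ultimately show "n \<in> fps_values ?J"
      using fps_values_action569[OF J, of m h] mh by blast
  qed (use ideal569_zero[OF J] ideal569_add[OF J] ideal569_scale[OF J] in auto)
  then obtain g where g: "g \<in> ?J" "f - g \<in> fps_tail (subdegree (gen6 \<alpha>) + 14)"
    unfolding subdegree_gen by auto
  obtain h where "h \<in> carrier S569" "f - g = gen6 \<alpha> * h"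
    using tail_multiple569[OF gen_carrier(1) gen_nonzero(1) g(2)] .
  then have "f = g + h * gen6 \<alpha>" "h * gen6 \<alpha> \<in> ?J"
    using ideal569_mult[OF J _ gen_mem(1)] by (auto simp: algebra_simps)
  then show ?thesis using ideal569_add[OF J g(1)] by blast
qed

text \<open>Modulo elements of order at least 11, a series in the ring without terms in degrees 0 and 5 has only
terms in degrees 6, 9 and 10, and the smallest positive element 5 of the semigroup is too large to
move these among each other.\<close>

lemma mult_nth_569:
  assumes "a \<in> carrier S569" "f \<in> carrier S569" "fps_nth f 0 = 0" "fps_nth f 5 = 0"
    and n: "n \<in> {0, 5, 6, 9, 10}"
  shows "fps_nth (a * f) n = fps_nth a 0 * fps_nth f n"
proof -
  have "fps_nth (a * f) n = (\<Sum>i\<in>{0..n}. fps_nth a i * fps_nth f (n - i))" by (rule fps_mult_nth)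
  also have "\<dots> = (\<Sum>i\<in>{0}. fps_nth a i * fps_nth f (n - i))"
  proof (rule sum.mono_neutral_right)
    show "\<forall>i\<in>{0..n} - {0}. fps_nth a i * fps_nth f (n - i) = 0"
    proof
      fix i assume i: "i \<in> {0..n} - {0}"
      then have "i \<in> {1, 2, 3, 4, 7, 8, 13} \<or> n - i \<in> {1, 2, 3, 4, 7, 8, 13} \<or> n - i = 0 \<or> n - i = 5"
        using n unfolding insert_iff empty_iff Diff_iff atLeastAtMost_iff by presburger
      then show "fps_nth a i * fps_nth f (n - i) = 0"
        using carrier569_gap[OF assms(1), of i] carrier569_gap[OF assms(2), of "n - i"] assms(3,4) by auto
    qed
  qed auto
  finally show ?thesis by simp
qed

text \<open>Membership in the ideal is a system of linear conditions on finitely many coefficients. This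
description makes the uniqueness of the parameters evident.\<close>

lemma gen_ideal_eq:
  "gen_ideal \<alpha> \<beta> = {f \<in> carrier S569. fps_nth f 0 = 0 \<and> fps_nth f 5 = 0 \<and>
     fps_nth f 10 = \<alpha> * fps_nth f 6 + \<beta> * fps_nth f 9}" (is "_ = ?C")
proof
  interpret domain S569 by (rule domain569)
  have "ideal ?C S569"
  proof (rule ideal569I)
    show "a * f \<in> ?C" if "a \<in> carrier S569" "f \<in> ?C" for a f
      using that mult_nth_569[of a f] by (auto simp: carrier569_mult algebra_simps)
  qed (auto simp: carrier569_add algebra_simps carrier569_const[of 0, simplified])
  moreover have "{gen6 \<alpha>, gen9 \<beta>} \<subseteq> ?C" using gen_carrier by auto
  ultimately show "gen_ideal \<alpha> \<beta> \<subseteq> ?C" by (rule genideal_minimal)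
next
  note J = ideal_gen_ideal[of \<alpha> \<beta>]
  show "?C \<subseteq> gen_ideal \<alpha> \<beta>"
  proof
    fix f assume f: "f \<in> ?C"
    define h where "h = fps_const (fps_nth f 6) * gen6 \<alpha> + fps_const (fps_nth f 9) * gen9 \<beta>"
    have h: "h \<in> gen_ideal \<alpha> \<beta>"
      unfolding h_def by (intro ideal569_add[OF J] ideal569_scale[OF J] gen_mem)
    have nth: "fps_nth h n = fps_nth f 6 * (if n = 6 then 1 else if n = 10 then \<alpha> else 0) +
        fps_nth f 9 * (if n = 9 then 1 else if n = 10 then \<beta> else 0)" for n
      unfolding h_def fps_add_nth fps_mult_left_const_nth gen_nth by simp
    have "f - h \<in> carrier S569"
      using carrier569_add[OF _ carrier569_uminus[OF ideal569_carrier[OF J h]]] f by auto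
    then have "f - h \<in> gen_ideal \<alpha> \<beta>"
      using f by (intro tail_subset_gen_ideal tail11_569) (auto simp: nth)
    then show "f \<in> gen_ideal \<alpha> \<beta>" using ideal569_add[OF J _ h] by fastforce
  qed
qed

lemma gen_ideal_inj: "gen_ideal \<alpha> \<beta> = gen_ideal \<alpha>' \<beta>' \<Longrightarrow> \<alpha> = \<alpha>' \<and> \<beta> = \<beta>'"
proof -
  assume "gen_ideal \<alpha> \<beta> = gen_ideal \<alpha>' \<beta>'"
  then have "gen6 \<alpha> \<in> gen_ideal \<alpha>' \<beta>'" "gen9 \<beta> \<in> gen_ideal \<alpha>' \<beta>'" using gen_mem by blast+
  then show ?thesis unfolding gen_ideal_eq by auto
qed

text \<open>Since \<open>I\<close> contains all elements of order at least 11 and orders 6 and 9, but not 10, occur, reduction of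
elements of orders 6 and 9 to normal form yields the two generators. The square of the second one is
\<open>t\<^sup>1\<^sup>8 + 2 \<beta> t\<^sup>1\<^sup>9 + \<dots>\<close>, whereas an element of \<open>x I\<close> of order 18 has no term of degree 19 because 7 and
13 are gaps; hence \<open>2 \<beta> = 0\<close>.\<close>

lemma (in ulrich569) eq_gen_ideal: "\<exists>\<alpha> \<beta>. 2 * \<beta> = 0 \<and> I = gen_ideal \<alpha> \<beta>"
proof -
  have low: "fps_nth f n = 0" if "f \<in> I" "n < 6" for f n
    using that e_le[OF fps_valuesI[OF that(1) _ refl]] values_eq
    by (cases "f = 0") (auto intro: nth_less_subdegree_zero)
  obtain y0 where y0: "y0 \<in> I" "y0 \<noteq> 0" "subdegree y0 = 9" using values_eq by (blast elim: fps_valuesE)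
  define \<beta> where "\<beta> = fps_nth y0 10 / fps_nth y0 9"
  have y0_9: "fps_nth y0 9 \<noteq> 0" using nth_subdegree_nonzero[OF y0(2)] unfolding y0(3) .
  have y0_low: "fps_nth y0 n = 0" if "n < 9" for n
    using nth_less_subdegree_zero[of n y0] that y0(3) by simp
  note diff = ideal569_diff[OF ideal] and scale = ideal569_scale[OF ideal] and add = ideal569_add[OF ideal]
  \<comment> \<open>Only the coefficients in degrees below 11 matter for membership in \<open>I\<close>.\<close>
  have absorb: "g \<in> I" if "g \<in> carrier S569" "f \<in> I" "\<And>n. n \<in> {0, 5, 6, 9, 10} \<Longrightarrow> fps_nth g n = fps_nth f n" for f g
  proof -
    have "g - f \<in> carrier S569"
      using carrier569_add[OF that(1) carrier569_uminus[OF carrier[OF that(2)]]] by simp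
    then have "g - f \<in> I" using that(3) by (intro tail11 tail11_569) auto
    then show ?thesis using add[OF _ that(2)] by fastforce
  qed
  have gen9: "gen9 \<beta> \<in> I"
    by (rule absorb[OF gen_carrier(2) scale[OF y0(1), of "1 / fps_nth y0 9"]])
       (use y0_9 y0_low in \<open>auto simp: \<beta>_def\<close>)
  have x6: "fps_nth x 6 \<noteq> 0" using nth_subdegree_nonzero[OF x(2)] values_eq by simp
  define x1 where "x1 = fps_const (1 / fps_nth x 6) * x"
  define x2 where "x2 = x1 - fps_const (fps_nth x1 9) * gen9 \<beta>"
  define \<alpha> where "\<alpha> = fps_nth x2 10"
  have x2: "x2 \<in> I" unfolding x2_def x1_def by (intro diff scale gen9 x)
  have "gen6 \<alpha> \<in> I"
    by (rule absorb[OF gen_carrier(1) x2])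
       (use x6 low[OF x2] in \<open>auto simp: \<alpha>_def x2_def x1_def\<close>)
  have "I \<subseteq> gen_ideal \<alpha> \<beta>"
  proof
    fix f assume f: "f \<in> I"
    define g where "g = f - (fps_const (fps_nth f 6) * gen6 \<alpha> + fps_const (fps_nth f 9) * gen9 \<beta>)"
    have g: "g \<in> I" unfolding g_def by (intro diff add scale f \<open>gen6 \<alpha> \<in> I\<close> gen9)
    have nth: "fps_nth g n = fps_nth f n - (fps_nth f 6 * (if n = 6 then 1 else if n = 10 then \<alpha> else 0) +
        fps_nth f 9 * (if n = 9 then 1 else if n = 10 then \<beta> else 0))" for n
      unfolding g_def fps_sub_nth fps_add_nth fps_mult_left_const_nth gen_nth by simp
    have "fps_nth g 10 = 0"
    proof (rule ccontr)
      assume g10: "fps_nth g 10 \<noteq> 0"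
      have "fps_nth g n = 0" if "n < 10" for n
      proof -
        have "n < 6 \<or> n \<in> {1, 2, 3, 4, 7, 8, 13} \<or> n = 6 \<or> n = 9"
          using that unfolding insert_iff empty_iff by presburger
        then show ?thesis
          using low[OF g, of n] carrier569_gap[OF carrier[OF g], of n] nth[of 6] nth[of 9] by auto
      qed
      then have "subdegree g = 10" using g10 by (intro subdegreeI)
      then have "10 \<in> E" using g g10 by (intro fps_valuesI[of g]) auto
      then show False using values_eq by simp
    qed
    then show "f \<in> gen_ideal \<alpha> \<beta>" using f carrier low by (simp add: gen_ideal_eq nth)
  qed
  moreover have "gen_ideal \<alpha> \<beta> \<subseteq> I"
  proof -
    interpret domain S569 by (rule domain569)
    show ?thesis using \<open>gen6 \<alpha> \<in> I\<close> gen9 by (intro genideal_minimal ideal) simp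
  qed
  moreover have "2 * \<beta> = 0"
  proof -
    obtain z where z: "z \<in> I" "gen9 \<beta> * gen9 \<beta> = x * z" using mult_in[OF gen9 gen9] by blast
    have z0: "z \<noteq> 0" using z(2) gen_nonzero(2)[of \<beta>] by auto
    have "subdegree (gen9 \<beta> * gen9 \<beta>) = 18" using gen_nonzero(2)[of \<beta>] by (simp add: subdegree_gen)
    then have sz: "subdegree z = 12" using z(2) z0 x(2) values_eq by simp
    have "fps_nth (x * z) 19 = (\<Sum>i=0..19. fps_nth x i * fps_nth z (19 - i))" by (rule fps_mult_nth)
    also have "\<dots> = 0"
    proof (rule sum.neutral, rule ballI)
      fix i :: nat assume "i \<in> {0..19}"
      then consider "i < 6" | "i = 6" | "i = 7" | "19 - i < 12" by fastforce
      then show "fps_nth x i * fps_nth z (19 - i) = 0"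
      proof cases
        case 1 then show ?thesis using low[OF x(1)] by simp
      next
        case 2 then show ?thesis using carrier569_gap[OF carrier[OF z(1)], of 13] by simp
      next
        case 3 then show ?thesis using carrier569_gap[OF carrier[OF x(1)], of 7] by simp
      next
        case 4
        then have "fps_nth z (19 - i) = 0" unfolding sz[symmetric] by (rule nth_less_subdegree_zero)
        then show ?thesis by simp
      qed
    qed
    finally have "fps_nth (gen9 \<beta> * gen9 \<beta>) 19 = 0" unfolding z(2) .
    then show ?thesis unfolding gen_square by simp
  qed
  ultimately show ?thesis by blast
qed

section \<open>The members of the family are Ulrich ideals\<close>

text \<open>In this ring every nonzero proper ideal is primary to the maximal ideal; the last assumption is the
form in which being nonzero enters.\<close>

lemma primary_to_max569:
  assumes J: "ideal J S569" "J \<subseteq> max_ideal569"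
    and tail: "\<And>f. f \<in> carrier S569 \<Longrightarrow> f \<in> fps_tail N \<Longrightarrow> f \<in> J"
  shows "primary_to S569 max_ideal569 J"
proof -
  interpret domain S569 by (rule domain569)
  have pow: "f [^]\<^bsub>S569\<^esub> n = f ^ n" for f :: "'a fps" and n :: nat
    by (induction n) (simp_all add: ring569_simps mult.commute)
  have proper: "J \<noteq> carrier S569"
    using J(2) max569_proper max569_def by blast
  have rad: "radical_ideal S569 J = max_ideal569"
  proof
    show "radical_ideal S569 J \<subseteq> max_ideal569"
    proof
      fix f assume "f \<in> radical_ideal S569 J"
      then obtain n where f: "f \<in> carrier S569" "f ^ n \<in> J" by (auto simp: radical_ideal_def pow)
      then have "fps_nth (f ^ n) 0 = 0" using J(2) by (auto simp: max569_def)
      then show "f \<in> max_ideal569" using f by (auto simp: max569_def fps_power_zeroth)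
    qed
    show "max_ideal569 \<subseteq> radical_ideal S569 J"
    proof
      fix f :: "'a fps" assume f: "f \<in> max_ideal569"
      then have fc: "f \<in> carrier S569" and "fps_nth f 0 = 0" by (auto simp: max569_def)
      then have "f ^ N \<in> fps_tail N" by (auto simp: fps_tail_def startsby_zero_power_prefix)
      moreover have "f ^ N \<in> carrier S569" using nat_pow_closed[OF fc, of N] by (simp add: pow)
      ultimately have "f ^ N \<in> J" using tail by blast
      then show "f \<in> radical_ideal S569 J" using fc by (auto simp: radical_ideal_def pow)
    qed
  qed
  moreover have "a \<in> J" if ab: "a \<in> carrier S569" "b \<in> carrier S569" "a * b \<in> J" "b \<notin> max_ideal569" for a b
  proof -
    have b0: "fps_nth b 0 \<noteq> 0" using ab by (simp add: max569_def)
    have "inverse b * (a * b) \<in> J" using ab(3) by (rule ideal569_mult[OF J(1) carrier569_inverse[OF ab(2) b0]])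
    moreover have "inverse b * (a * b) = a" using inverse_mult_eq_1[OF b0] by (simp add: mult.left_commute)
    ultimately show ?thesis by simp
  qed
  ultimately show ?thesis
    using J proper unfolding primary_to_def by (auto simp: ring569_simps)
qed

locale gen_pair =
  fixes \<alpha> \<beta> :: "'k::field"
begin

abbreviation "J \<equiv> gen_ideal \<alpha> \<beta>"
abbreviation "x \<equiv> gen6 \<alpha>"
abbreviation "y \<equiv> gen9 \<beta>"

lemma gen_ideal_span:
  assumes "f \<in> J"
  obtains a b where "a \<in> carrier S569" "b \<in> carrier S569" "f = a * x + b * y"
proof -
  interpret domain S569 by (rule domain569)
  let ?L = "{a * x + b * y | a b. a \<in> carrier S569 \<and> b \<in> carrier S569}"
  have 01: "0 \<in> carrier (S569 :: 'k fps ring)" "1 \<in> carrier (S569 :: 'k fps ring)"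
    using carrier569_const[of 0] carrier569_const[of 1] by auto
  have "ideal ?L S569"
  proof (rule ideal569I)
    show "?L \<subseteq> carrier S569"
      using gen_carrier by (auto intro!: carrier569_add carrier569_mult)
    show "0 \<in> ?L" using 01 by force
    show "f + g \<in> ?L" if f: "f \<in> ?L" and g: "g \<in> ?L" for f g
    proof -
      obtain a b c d where "f = a * x + b * y" "g = c * x + d * y" 
        and c: "a \<in> carrier S569" "b \<in> carrier S569" "c \<in> carrier S569" "d \<in> carrier S569"
        using f g by blast
      then have "f + g = (a + c) * x + (b + d) * y" by (simp only: algebra_simps)
      then show ?thesis using c carrier569_add by blast
    qed
    show "c * f \<in> ?L" if c: "c \<in> carrier S569" and f: "f \<in> ?L" for c f
    proof -
      obtain a b where "f = a * x + b * y" and ab: "a \<in> carrier S569" "b \<in> carrier S569"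
        using f by blast
      then have "c * f = (c * a) * x + (c * b) * y" by (simp only: algebra_simps)
      then show ?thesis using ab c carrier569_mult by blast
    qed
  qed
  moreover have "x = 1 * x + 0 * y" "y = 0 * x + 1 * y" by simp_all
  then have "{x, y} \<subseteq> ?L" using 01 by blast
  ultimately have "J \<subseteq> ?L" by (rule genideal_minimal)
  then show thesis using assms that by blast
qed

text \<open>The quotient \<open>b y / x\<close> has order 3, 8 or 13, which are gaps.\<close>

lemma not_principal569:
  assumes b: "b \<noteq> 0" "subdegree b \<in> {0, 5, 10}" and c: "c \<in> carrier S569"
  shows "b * y \<noteq> x * c"
proof
  assume eq: "b * y = x * c"
  then have "c \<noteq> 0" using b gen_nonzero(2)[of \<beta>] by auto
  then have "subdegree b + 9 = 6 + subdegree c"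
    using arg_cong[OF eq, of subdegree] b gen_nonzero(1)[of \<alpha>] gen_nonzero(2)[of \<beta>]
    by (simp add: subdegree_gen)
  moreover have "subdegree c \<in> semigroup569"
    using c \<open>c \<noteq> 0\<close> by (intro fps_values569[of "carrier (S569 :: 'k fps ring)", OF order.refl] fps_valuesI[of c]) auto
  ultimately show False using b(2) by (auto simp: mem_semigroup569_iff)
qed

text \<open>When \<open>2 \<beta> = 0\<close>, the elements \<open>y\<^sup>2\<close> and \<open>t\<^sup>6 x\<^sup>2\<close> agree below degree 20 = 6 + 14, so their
difference is a multiple of \<open>x\<close>.\<close>

lemma gen9_square:
  assumes two: "2 * \<beta> = 0"
  shows "\<exists>z\<in>J. y * y = x * z"
proof -
  have "y * y - fps_X ^ 6 * (x * x) = fps_const (\<beta> * \<beta>) * fps_X ^ 20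
      - fps_const (2 * \<alpha>) * fps_X ^ 22 - fps_const (\<alpha> * \<alpha>) * fps_X ^ 26"
    unfolding gen_square two by (simp add: algebra_simps flip: power_add)
  then have diff: "y * y - fps_X ^ 6 * (x * x) \<in> fps_tail (subdegree x + 14)"
    unfolding subdegree_gen by (auto simp: fps_tail_def)
  then obtain h where h: "h \<in> carrier S569" "y * y - fps_X ^ 6 * (x * x) = x * h"
    by (rule tail_multiple569[OF gen_carrier(1) gen_nonzero(1)])
  have "h \<in> fps_tail 14"
    using diff gen_nonzero(1) unfolding h(2) by (rule fps_tail_cancel)
  then have "h \<in> J" using h(1) by (intro tail_subset_gen_ideal) (auto elim: fps_tail_mono)
  moreover have "fps_X ^ 6 * x \<in> J"
    by (intro ideal569_mult[OF ideal_gen_ideal] gen_mem) (simp add: monom569_iff mem_semigroup569_iff)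
  ultimately have "fps_X ^ 6 * x + h \<in> J" by (intro ideal569_add[OF ideal_gen_ideal])
  moreover have "y * y = x * (fps_X ^ 6 * x + h)" using h(2) by (simp only: algebra_simps)
  ultimately show ?thesis by blast
qed

lemma gen_ideal_stable:
  assumes two: "2 * \<beta> = 0"
  shows "J \<cdot>\<^bsub>S569\<^esub> J = (\<lambda>z. x * z) ` J"
proof
  note J = ideal_gen_ideal[of \<alpha> \<beta>]
  note intros = ideal569_add[OF J] ideal569_mult[OF J] carrier569_add carrier569_mult
    gen_mem[where \<alpha> = \<alpha> and \<beta> = \<beta>]
  obtain z where z: "z \<in> J" "y * y = x * z" using gen9_square[OF two] by blast
  show "J \<cdot>\<^bsub>S569\<^esub> J \<subseteq> (\<lambda>z. x * z) ` J"
  proof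
    fix w assume "w \<in> J \<cdot>\<^bsub>S569\<^esub> J"
    then show "w \<in> (\<lambda>z. x * z) ` J"
    proof (induction rule: ideal_prod.induct)
      case (prod f g)
      obtain a b where ab: "a \<in> carrier S569" "b \<in> carrier S569" "f = a * x + b * y"
        using gen_ideal_span[OF prod(1)] .
      obtain c d where cd: "c \<in> carrier S569" "d \<in> carrier S569" "g = c * x + d * y"
        using gen_ideal_span[OF prod(2)] .
      have "f * g = x * ((a * c) * x + (a * d + b * c) * y) + (b * d) * (y * y)"
        unfolding ab(3) cd(3) by (simp only: algebra_simps)
      also have "\<dots> = x * ((a * c) * x + (a * d + b * c) * y + (b * d) * z)"
        unfolding z(2) by (simp only: algebra_simps)
      finally have "f * g = \<dots>" .
      moreover have "(a * c) * x + (a * d + b * c) * y + (b * d) * z \<in> J"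
        using ab cd z by (intro intros)
      ultimately show ?case unfolding ring569_simps by blast
    next
      case (sum u v)
      then obtain u' v' where "u' \<in> J" "v' \<in> J" "u = x * u'" "v = x * v'" by blast
      then have "u + v = x * (u' + v')" "u' + v' \<in> J" by (simp only: distrib_left, intro intros)
      then show ?case unfolding ring569_simps by blast
    qed
  qed
  show "(\<lambda>z. x * z) ` J \<subseteq> J \<cdot>\<^bsub>S569\<^esub> J"
    using ideal_prod.prod[OF gen_mem(1), of _ J S569] by (auto simp: ring569_simps)
qed

text \<open>In a relation \<open>a x + b y\<close> in \<open>I\<^sup>2 = x I\<close> the element \<open>b y\<close> is a multiple of \<open>x\<close>. Reducing \<open>b\<close> modulo the
generators makes its order 0, 5, 10 or at least 11; the first three are excluded by
\<open>not_principal569\<close>. So \<open>b\<close> is in \<open>I\<close>, and dividing by \<open>x\<close> shows that \<open>a\<close> is in \<open>I\<close> as well.\<close>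

lemma gen_ideal_conormal_free:
  assumes two: "2 * \<beta> = 0"
  shows "free_module (S569 Quot J) (conormal_module S569 J)"
proof -
  interpret domain S569 by (rule domain569)
  note J = ideal_gen_ideal[of \<alpha> \<beta>]
  interpret J: ideal J S569 by (rule J)
  have R: "cring S569" by (rule is_cring)
  show ?thesis
  proof (rule J.free_conormal_two_generators[OF R _ gen_mem])
    have "(1 :: 'k fps) \<in> carrier S569" using carrier569_const[of 1] by simp
    moreover have "(1 :: 'k fps) \<notin> J" unfolding gen_ideal_eq by simp
    ultimately show "J \<noteq> carrier S569" by blast
  next
    fix f assume "f \<in> J"
    then show "\<exists>a\<in>carrier S569. \<exists>b\<in>carrier S569. f = a \<otimes>\<^bsub>S569\<^esub> x \<oplus>\<^bsub>S569\<^esub> b \<otimes>\<^bsub>S569\<^esub> y"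
      unfolding ring569_simps using gen_ideal_span by metis
  next
    fix a b :: "'k fps"
    assume a: "a \<in> carrier S569" and b: "b \<in> carrier S569"
      and "a \<otimes>\<^bsub>S569\<^esub> x \<oplus>\<^bsub>S569\<^esub> b \<otimes>\<^bsub>S569\<^esub> y \<in> J \<cdot>\<^bsub>S569\<^esub> J"
    then obtain z where z: "z \<in> J" "a * x + b * y = x * z"
      unfolding gen_ideal_stable[OF two] ring569_simps by blast
    define h where "h = fps_const (fps_nth b 6) * x + fps_const (fps_nth b 9) * y"
    have h: "h \<in> J"
      unfolding h_def by (intro ideal569_add[OF J] ideal569_scale[OF J] gen_mem)
    have yJ: "\<exists>w\<in>J. f * y = x * w" if "f \<in> J" for f
      using ideal_prod.prod[OF that gen_mem(2)[where \<alpha> = \<alpha> and \<beta> = \<beta>], of S569] unfolding gen_ideal_stable[OF two] ring569_simps by blast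
    define b' where "b' = b - h"
    have b'c: "b' \<in> carrier S569"
      using carrier569_add[OF b carrier569_uminus[OF ideal569_carrier[OF J h]]] by (simp add: b'_def)
    have nth: "fps_nth b' n = fps_nth b n - (fps_nth b 6 * (if n = 6 then 1 else if n = 10 then \<alpha> else 0) +
        fps_nth b 9 * (if n = 9 then 1 else if n = 10 then \<beta> else 0))" for n
      unfolding b'_def h_def fps_sub_nth fps_add_nth fps_mult_left_const_nth gen_nth by simp
    obtain w where w: "w \<in> J" "h * y = x * w" using yJ[OF h] by blast
    have "b' * y = (a * x + b * y) - a * x - h * y" by (simp add: b'_def left_diff_distrib)
    also have "\<dots> = x * (z - a - w)" unfolding z(2) w(2) by (simp only: algebra_simps)
    finally have eq: "b' * y = x * (z - a - w)" .
    have "z - a - w = (z - w) + - a" by simp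
    then have zaw: "z - a - w \<in> carrier S569"
      using carrier569_add[OF ideal569_carrier[OF J ideal569_diff[OF J z(1) w(1)]] carrier569_uminus[OF a]] by metis
    have "b' \<in> fps_tail 11"
    proof (cases "b' = 0")
      case False
      have "subdegree b' \<notin> {0, 5, 10}" using not_principal569[OF False _ zaw] eq by blast
      moreover have "subdegree b' \<noteq> 6" "subdegree b' \<noteq> 9"
        using nth_subdegree_nonzero[OF False] by (auto simp: nth)
      moreover have "subdegree b' \<in> semigroup569"
        using b'c False by (intro fps_values569[of "carrier (S569 :: 'k fps ring)", OF order.refl] fps_valuesI[of b']) auto
      ultimately show ?thesis by (auto simp: fps_tail_iff mem_semigroup569_iff)
    qed (simp add: fps_tail_def)
    then have "b' \<in> J" using b'c by (intro tail_subset_gen_ideal)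
    then have bJ: "b \<in> J" using ideal569_add[OF J _ h, of b'] by (simp add: b'_def)
    obtain v where v: "v \<in> J" "b * y = x * v" using yJ[OF bJ] by blast
    have "x * a = x * (z - v)" using z(2) v(2) by (simp only: algebra_simps)
    then have "a = z - v" using gen_nonzero(1)[of \<alpha>] by (simp only: mult_cancel_left) blast
    then show "a \<in> J \<and> b \<in> J" using bJ ideal569_diff[OF J z(1) v(1)] by blast
  qed
qed

lemma gen_ideal_ulrich:
  assumes two: "2 * \<beta> = 0"
  shows "ulrich_ideal S569 J"
proof -
  interpret domain S569 by (rule domain569)
  note J = ideal_gen_ideal[of \<alpha> \<beta>]
  let ?Q = "Idl\<^bsub>S569\<^esub> {x}"
  have xc: "x \<in> carrier S569" by (rule gen_carrier)
  have Q: "ideal ?Q S569" using xc by (intro genideal_ideal) simp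
  have Q_eq: "?Q = (\<lambda>a. x * a) ` carrier S569" by (rule principal569[OF xc])
  have QJ: "?Q \<subseteq> J" using gen_mem by (intro genideal_minimal J) simp
  have Jm: "J \<subseteq> max_ideal569" unfolding gen_ideal_eq max569_def by blast
  have stable: "J \<cdot>\<^bsub>S569\<^esub> J = ?Q \<cdot>\<^bsub>S569\<^esub> J"
    unfolding gen_ideal_stable[OF two] principal_prod569[OF xc J] ..
  have primJ: "primary_to S569 max_ideal569 J"
    by (rule primary_to_max569[OF J Jm]) (rule tail_subset_gen_ideal)
  have "primary_to S569 max_ideal569 ?Q"
  proof (rule primary_to_max569[OF Q])
    show "?Q \<subseteq> max_ideal569" using QJ Jm by blast
    show "f \<in> ?Q" if "f \<in> fps_tail (subdegree x + 14)" for f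
      using tail_multiple569[OF xc gen_nonzero(1) that] unfolding Q_eq by blast
  qed
  then have par: "parameter_ideal S569 max_ideal569 ?Q" using xc by (auto simp: parameter_ideal_def)
  interpret ideals: comm_monoid "ideals_set S569" by (rule ideals_set_is_comm_monoid)
  have "J \<in> carrier (ideals_set S569)" using J by (simp add: ideals_set_def)
  then have "J [^]\<^bsub>ideals_set S569\<^esub> (1::nat) = J" by (rule ideals.nat_pow_eone)
  moreover from this have "J [^]\<^bsub>ideals_set S569\<^esub> Suc 1 = J \<cdot>\<^bsub>S569\<^esub> J"
    by (subst ideals.nat_pow_Suc) (simp add: ideals_set_def)
  ultimately have red: "is_reduction S569 ?Q J"
    unfolding is_reduction_def using Q QJ stable by (intro conjI exI[of _ "1::nat"]) simp_all
  have "y \<notin> ?Q"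
    using not_principal569[of 1] unfolding Q_eq by auto
  then have "J \<noteq> ?Q" using gen_mem(2) by blast
  then show ?thesis
    unfolding ulrich_ideal_def
    using primJ par red stable gen_ideal_conormal_free[OF two]
    by (intro exI[of _ max_ideal569] exI[of _ ?Q] conjI cm_local_ring_dim1_semigroup_ring569)
qed

end

section \<open>The classification\<close>

lemma ulrich_ideal_imp_locale:
  assumes "ulrich_ideal S569 I"
  shows "\<exists>x. ulrich569 I x"
proof -
  interpret domain S569 by (rule domain569)
  obtain \<mm> Q where cm: "cm_local_ring_dim1 S569 \<mm>" and prim: "primary_to S569 \<mm> I"
    and Q: "parameter_ideal S569 \<mm> Q" "is_reduction S569 Q I" "I \<noteq> Q" "I \<cdot>\<^bsub>S569\<^esub> I = Q \<cdot>\<^bsub>S569\<^esub> I"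
    and free: "free_module (S569 Quot I) (conormal_module S569 I)"
    using assms unfolding ulrich_ideal_def by blast
  have mm: "\<mm> = max_ideal569"
    using cm_local_ring_dim1.local[OF cm] local569 by blast
  obtain x where x: "x \<in> carrier S569" "Q = Idl\<^bsub>S569\<^esub> {x}" and primQ: "primary_to S569 \<mm> Q"
    using Q by (auto simp: parameter_ideal_def)
  have I: "ideal I S569" "I \<noteq> carrier S569" using prim by (auto simp: primary_to_def)
  have xI: "x \<in> I" using Q(2) genideal_self'[OF x(1)] by (auto simp: is_reduction_def x(2))
  have "x \<noteq> 0"
  proof
    assume "x = 0"
    then have Q0: "Q = {0}" using x principal569[OF x(1)] carrier569_const[of 0] by (auto simp: image_iff)
    have "(fps_X ^ 5 :: 'a fps) \<in> radical_ideal S569 Q"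
      using primQ monom569 by (auto simp: primary_to_def mm)
    then obtain n :: nat where "(fps_X ^ 5 :: 'a fps) [^]\<^bsub>S569\<^esub> n = 0"
      by (auto simp: radical_ideal_def Q0)
    moreover have "(fps_X ^ 5 :: 'a fps) [^]\<^bsub>S569\<^esub> n = (fps_X ^ 5) ^ n" for n :: nat
      by (induction n) (simp_all add: ring569_simps mult.commute)
    ultimately show False by simp
  qed
  then have "ulrich569 I x"
    using I xI Q free proper_ideal569[OF I] principal_prod569[OF x(1) I(1)] principal569[OF x(1)]
    by (intro ulrich569.intro) (simp_all add: x(2))
  then show ?thesis ..
qed

theorem proposition3p1:
  shows "ulrich_ideals (semigroup_ring569 :: 'k::field fps ring) =
      {Idl\<^bsub>semigroup_ring569\<^esub> {fps_X ^ 6 + fps_const \<alpha> * fps_X ^ 10, fps_X ^ 9 + fps_const \<beta> * fps_X ^ 10}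
        | \<alpha> \<beta>. 2 * \<beta> = 0} \<and>
    (\<forall>I \<in> ulrich_ideals (semigroup_ring569 :: 'k::field fps ring).
      \<exists>!(\<alpha>, \<beta>). 2 * \<beta> = 0 \<and>
        I = Idl\<^bsub>semigroup_ring569\<^esub> {fps_X ^ 6 + fps_const \<alpha> * fps_X ^ 10, fps_X ^ 9 + fps_const \<beta> * fps_X ^ 10})"
proof -
  have forward: "\<exists>\<alpha> \<beta>. 2 * \<beta> = 0 \<and> I = gen_ideal \<alpha> \<beta>" if "I \<in> ulrich_ideals S569" for I :: "'k fps set"
    using that ulrich_ideal_imp_locale ulrich569.eq_gen_ideal unfolding ulrich_ideals_def by blast
  have backward: "gen_ideal \<alpha> \<beta> \<in> ulrich_ideals S569" if "2 * \<beta> = 0" for \<alpha> \<beta> :: 'k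
    using gen_pair.gen_ideal_ulrich[OF that] by (simp add: ulrich_ideals_def)
  have unique: "\<exists>!(\<alpha>, \<beta>). 2 * \<beta> = 0 \<and> I = gen_ideal \<alpha> \<beta>" if I: "I \<in> ulrich_ideals S569" for I :: "'k fps set"
  proof -
    obtain \<alpha> \<beta> where ab: "2 * \<beta> = 0" "I = gen_ideal \<alpha> \<beta>" using forward[OF I] by blast
    show ?thesis
    proof (rule ex1I[of _ "(\<alpha>, \<beta>)"])
      show "case (\<alpha>, \<beta>) of (\<alpha>, \<beta>) \<Rightarrow> 2 * \<beta> = 0 \<and> I = gen_ideal \<alpha> \<beta>" using ab by simp
      fix p assume p: "case p of (\<alpha>, \<beta>) \<Rightarrow> 2 * \<beta> = 0 \<and> I = gen_ideal \<alpha> \<beta>"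
      obtain \<alpha>' \<beta>' where p': "p = (\<alpha>', \<beta>')" by (cases p)
      have "gen_ideal \<alpha>' \<beta>' = gen_ideal \<alpha> \<beta>" using p ab unfolding p' by simp
      then show "p = (\<alpha>, \<beta>)" unfolding p' using gen_ideal_inj by blast
    qed
  qed
  show ?thesis
    unfolding gen6_def[symmetric] gen9_def[symmetric]
  proof (intro conjI ballI)
    show "ulrich_ideals S569 = {gen_ideal \<alpha> \<beta> | \<alpha> \<beta> :: 'k. 2 * \<beta> = 0}"
      using forward backward by blast
    show "\<exists>!(\<alpha>, \<beta>). 2 * \<beta> = 0 \<and> I = gen_ideal \<alpha> \<beta>" if "I \<in> ulrich_ideals S569" for I :: "'k fps set"
      using unique[OF that] .
  qed
qed

end
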